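(* Let $H$ be a graph which has a vertex whose removal makes the graph acyclic (i.e., a forest). Then there exists a constant $c_H>0$ such that for every positive integer $m$, $$\mathrm{sp}(m,H)\geq c_H\, m^{4/5}.$$
   Context: All graphs are finite and simple. For a graph $G$, $\mathrm{mc}(G)$ is the maximum number of edges of a bipartite subgraph of $G$, and the surplus of $G$ is $\mathrm{sp}(G)=\mathrm{mc}(G)-e(G)/2$, where $e(G)$ is the number of edges. A graph is $H$-free if it contains no (not necessarily induced) subgraph isomorphic to $H$. For a positive integer $m$ and a graph $H$, $\mathrm{sp}(m,H)$ is the minimum of $\mathrm{sp}(G)$ over all $H$-free graphs $G$ with exactly $m$ edges. *)

theory Defs
  imports Complex_Main "HOL-Library.Extended_Real"
begin

text \<open>A graph is a pair of a vertex set and a set of edges, each edge being a two-element set of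
  vertices.\<close>

type_synonym 'a ugraph = "'a set \<times> 'a set set"

abbreviation vertices :: "'a ugraph \<Rightarrow> 'a set" where
  "vertices G \<equiv> fst G"

abbreviation edges :: "'a ugraph \<Rightarrow> 'a set set" where
  "edges G \<equiv> snd G"

definition simple_graph :: "'a ugraph \<Rightarrow> bool" where
  "simple_graph G \<longleftrightarrow>
     finite (vertices G) \<and> (\<forall>e \<in> edges G. e \<subseteq> vertices G \<and> card e = 2)"

definition is_subgraph :: "'a ugraph \<Rightarrow> 'a ugraph \<Rightarrow> bool" where
  "is_subgraph K G \<longleftrightarrow>
     simple_graph K \<and> vertices K \<subseteq> vertices G \<and> edges K \<subseteq> edges G"

definition graph_isomorphic :: "'a ugraph \<Rightarrow> 'b ugraph \<Rightarrow> bool" where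
  "graph_isomorphic G K \<longleftrightarrow>
     (\<exists>f. bij_betw f (vertices G) (vertices K) \<and>
        (\<forall>u \<in> vertices G. \<forall>v \<in> vertices G. {u, v} \<in> edges G \<longleftrightarrow> {f u, f v} \<in> edges K))"

definition graph_free :: "'a ugraph \<Rightarrow> 'b ugraph \<Rightarrow> bool" where
  "graph_free H G \<longleftrightarrow> \<not> (\<exists>K. is_subgraph K G \<and> graph_isomorphic H K)"

definition bipartite_graph :: "'a ugraph \<Rightarrow> bool" where
  "bipartite_graph G \<longleftrightarrow>
     (\<exists>X Y. X \<union> Y = vertices G \<and> X \<inter> Y = {} \<and>
        (\<forall>e \<in> edges G. \<exists>x \<in> X. \<exists>y \<in> Y. e = {x, y}))"

definition mc :: "'a ugraph \<Rightarrow> nat" where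
  "mc G = Max {card (edges B) | B. is_subgraph B G \<and> bipartite_graph B}"

definition surplus :: "'a ugraph \<Rightarrow> real" where
  "surplus G = real (mc G) - real (card (edges G)) / 2"

text \<open>A cycle is given by its cyclic sequence of at least three distinct vertices.\<close>

definition graph_cycle :: "'a ugraph \<Rightarrow> 'a list \<Rightarrow> bool" where
  "graph_cycle G p \<longleftrightarrow>
     3 \<le> length p \<and> distinct p \<and> set p \<subseteq> vertices G \<and>
     (\<forall>i < length p. {p ! i, p ! (Suc i mod length p)} \<in> edges G)"

definition acyclic_graph :: "'a ugraph \<Rightarrow> bool" where
  "acyclic_graph G \<longleftrightarrow> \<not> (\<exists>p. graph_cycle G p)"

definition delete_vertex :: "'a ugraph \<Rightarrow> 'a \<Rightarrow> 'a ugraph" where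
  "delete_vertex G v = (vertices G - {v}, {e \<in> edges G. v \<notin> e})"

text \<open>The class over which the minimum is taken uses natural numbers as vertices; every finite
  graph is isomorphic to such a graph.\<close>

definition free_graphs :: "nat \<Rightarrow> 'a ugraph \<Rightarrow> nat ugraph set" where
  "free_graphs m H = {G. simple_graph G \<and> graph_free H G \<and> card (edges G) = m}"

text \<open>The value is an extended real because no \<open>H\<close>-free graph with \<open>m\<close> edges need exist (for
  instance if \<open>H\<close> is a single edge and \<open>m > 0\<close>); the minimum over the empty class is then infinite.
  In all other cases the infimum is attained, see \<open>min_surplus_attained\<close> below.\<close>

definition min_surplus :: "nat \<Rightarrow> 'a ugraph \<Rightarrow> ereal" where
  "min_surplus m H = (INF G \<in> free_graphs m H. ereal (surplus G))"

lemma finite_edges: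
  assumes "simple_graph G"
  shows "finite (edges G)"
proof (rule finite_subset)
  show "edges G \<subseteq> Pow (vertices G)" "finite (Pow (vertices G))"
    using assms by (auto simp: simple_graph_def)
qed

lemma mc_attained:
  assumes "simple_graph G"
  shows "\<exists>B. is_subgraph B G \<and> bipartite_graph B \<and> card (edges B) = mc G"
proof -
  let ?S = "{card (edges B) | B. is_subgraph B G \<and> bipartite_graph B}"
  have "?S \<subseteq> {..card (edges G)}"
    using card_mono[OF finite_edges[OF assms]] by (auto simp: is_subgraph_def)
  then have fin: "finite ?S"
    by (rule finite_subset) simp
  have "is_subgraph ({}, {}) G" "bipartite_graph ({}, {})"
    by (auto simp: is_subgraph_def simple_graph_def bipartite_graph_def)
  then have "?S \<noteq> {}"
    by blast
  from Max_in[OF fin this] have "mc G \<in> ?S"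
    unfolding mc_def .
  then show ?thesis
    by (smt (verit) mem_Collect_eq)
qed

lemma mc_le_edges:
  assumes "simple_graph G"
  shows "mc G \<le> card (edges G)"
  using mc_attained[OF assms] card_mono[OF finite_edges[OF assms]]
  unfolding is_subgraph_def by metis

lemma min_surplus_attained:
  assumes "free_graphs m H \<noteq> {}"
  shows "\<exists>G \<in> free_graphs m H. min_surplus m H = ereal (surplus G)"
proof -
  let ?S = "(\<lambda>G. ereal (surplus G)) ` free_graphs m H"
  have "?S \<subseteq> (\<lambda>k. ereal (real k - real m / 2)) ` {..m}"
    using mc_le_edges by (fastforce simp: free_graphs_def surplus_def)
  then have "finite ?S"
    by (rule finite_subset) simp
  then have "Inf ?S \<in> ?S"
    using assms Min_in[of ?S] Min_Inf[of ?S] by auto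
  then show ?thesis
    unfolding min_surplus_def by auto
qed

end

theory Submission
  imports Defs
begin

text \<open>If the edge products of a \<open>[-1, 1]\<close>-valued random function on the vertices of \<open>G\<close> have
  expectations summing to \<open>- t\<close>, then \<open>G\<close> has surplus at least \<open>t / 2\<close>. In an \<open>H\<close>-free graph no
  neighbourhood contains the forest obtained from \<open>H\<close>, hence neighbourhoods span only linearly many
  edges and an average edge lies in few triangles. A threshold \<open>D\<close> of order \<open>m powr (2 / 5)\<close> separates
  two cases. If \<open>G\<close> is \<open>D\<close>-degenerate, orient its edges with out-degrees at most \<open>D\<close>; the sine of
  the random sign of a vertex minus a small multiple of the signs of its out-neighbours has correlation
  of order \<open>- 1 / sqrt D\<close> along a typical edge, which gives surplus of order \<open>m / sqrt D\<close>. Otherwise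
  some induced subgraph on \<open>N \<le> 2 m / D\<close> vertices has minimum degree above \<open>D\<close>; fix sets of
  about \<open>D / 4\<close> neighbours of every vertex and draw a random list of about \<open>N / D\<close> vertices. The
  indicators that the list avoids these sets, once centred, have correlation of order \<open>- D / N\<close> along a
  typical edge, which gives surplus of order \<open>D\<^sup>2\<close>.\<close>

section \<open>Rounding fractional cuts\<close>

text \<open>Edges are sets, so \<open>x\<close> enters each product at most once. The coefficient of
  \<open>t\<close> therefore does not involve the value at \<open>x\<close>, which makes the sum
  affine in that coordinate.\<close>

lemma prod_sum_fun_upd:
  fixes f :: "'v \<Rightarrow> real"
  assumes "finite E" "\<And>e. e \<in> E \<Longrightarrow> finite e"
  shows "(\<Sum>e\<in>E. \<Prod>w\<in>e. (f(x := t)) w) =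
    (\<Sum>e\<in>{e\<in>E. x \<notin> e}. \<Prod>w\<in>e. f w) + t * (\<Sum>e\<in>{e\<in>E. x \<in> e}. \<Prod>w\<in>e - {x}. f w)"
proof -
  have "E = {e\<in>E. x \<notin> e} \<union> {e\<in>E. x \<in> e}" by auto
  then have "(\<Sum>e\<in>E. \<Prod>w\<in>e. (f(x := t)) w) =
    (\<Sum>e\<in>{e\<in>E. x \<notin> e}. \<Prod>w\<in>e. (f(x := t)) w) + (\<Sum>e\<in>{e\<in>E. x \<in> e}. \<Prod>w\<in>e. (f(x := t)) w)"
    using assms(1) by (subst sum.union_disjoint[symmetric]) auto
  moreover have "(\<Prod>w\<in>e. (f(x := t)) w) = (\<Prod>w\<in>e. f w)" if "x \<notin> e" for e
    using that by (intro prod.cong) auto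
  moreover have "(\<Prod>w\<in>e. (f(x := t)) w) = t * (\<Prod>w\<in>e - {x}. f w)" if "e \<in> E" "x \<in> e" for e
  proof -
    have "(\<Prod>w\<in>e. (f(x := t)) w) = t * (\<Prod>w\<in>e - {x}. (f(x := t)) w)"
      using assms(2) that by (subst prod.remove[of e x]) auto
    also have "(\<Prod>w\<in>e - {x}. (f(x := t)) w) = (\<Prod>w\<in>e - {x}. f w)"
      by (intro prod.cong) auto
    finally show ?thesis .
  qed
  ultimately show ?thesis
    by (simp add: sum_distrib_left)
qed

text \<open>The sum is affine in every single coordinate, so it does not increase when the coordinates
  are moved one after the other to a suitable endpoint of \<open>[-1, 1]\<close>.\<close>

lemma multilinear_rounding:
  fixes f :: "'v \<Rightarrow> real"
  assumes "finite E" "\<And>e. e \<in> E \<Longrightarrow> finite e" "finite U"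
    and "\<And>v. \<bar>f v\<bar> \<le> 1"
  shows "\<exists>g. (\<forall>v\<in>U. g v = 1 \<or> g v = -1) \<and> (\<forall>v. \<bar>g v\<bar> \<le> 1) \<and>
    (\<Sum>e\<in>E. \<Prod>w\<in>e. g w) \<le> (\<Sum>e\<in>E. \<Prod>w\<in>e. f w)"
  using assms(3)
proof (induction U)
  case empty
  then show ?case using assms(4) by auto
next
  case (insert x U)
  then obtain g where g: "\<forall>v\<in>U. g v = 1 \<or> g v = -1" "\<forall>v. \<bar>g v\<bar> \<le> 1"
    "(\<Sum>e\<in>E. \<Prod>w\<in>e. g w) \<le> (\<Sum>e\<in>E. \<Prod>w\<in>e. f w)"
    by auto
  \<comment> \<open>\<open>L\<close> is the slope in coordinate \<open>x\<close>; moving to the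
    endpoint of opposite sign cannot increase the sum.\<close>
  define L where "L = (\<Sum>e\<in>{e\<in>E. x \<in> e}. \<Prod>w\<in>e - {x}. g w)"
  define t :: real where "t = (if L \<ge> 0 then -1 else 1)"
  have "t * L \<le> g x * L"
  proof (cases "L \<ge> 0")
    case True
    then have "(-1) * L \<le> g x * L"
      using g(2)[rule_format, of x] by (intro mult_right_mono) auto
    with True show ?thesis by (simp add: t_def)
  next
    case False
    then have "1 * L \<le> g x * L"
      using g(2)[rule_format, of x] by (intro mult_right_mono_neg) auto
    with False show ?thesis by (simp add: t_def)
  qed
  \<comment> \<open>Here \<open>g(x := g x)\<close> is \<open>g\<close> itself, written as an update
    so that both sides split in the same way.\<close>
  then have "(\<Sum>e\<in>E. \<Prod>w\<in>e. (g(x := t)) w) \<le> (\<Sum>e\<in>E. \<Prod>w\<in>e. (g(x := g x)) w)"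
    using prod_sum_fun_upd[OF assms(1,2), of g x t] prod_sum_fun_upd[OF assms(1,2), of g x "g x"]
    unfolding L_def by linarith
  then have "(\<Sum>e\<in>E. \<Prod>w\<in>e. (g(x := t)) w) \<le> (\<Sum>e\<in>E. \<Prod>w\<in>e. f w)"
    using g(3) by simp
  moreover have "\<forall>v\<in>insert x U. (g(x := t)) v = 1 \<or> (g(x := t)) v = -1"
    using g(1) by (auto simp: t_def)
  moreover have "\<forall>v. \<bar>(g(x := t)) v\<bar> \<le> 1"
    using g(2) by (auto simp: t_def)
  ultimately show ?case by blast
qed

lemma simple_edge:
  assumes "simple_graph G" "e \<in> edges G"
  obtains u v where "e = {u, v}" "u \<noteq> v" "u \<in> vertices G" "v \<in> vertices G"
proof -
  have "card e = 2" "e \<subseteq> vertices G" using assms by (auto simp: simple_graph_def)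
  then obtain u v where "e = {u, v}" "u \<noteq> v" by (auto simp: card_2_iff)
  with \<open>e \<subseteq> vertices G\<close> that show ?thesis by auto
qed

lemma finite_edge: "simple_graph G \<Longrightarrow> e \<in> edges G \<Longrightarrow> finite e"
  by (erule simple_edge) auto

text \<open>The two sign classes form a cut. Cut edges contribute -1 and all others 1, so the sum of
  the products is the number of edges minus twice the size of the cut.\<close>

lemma surplus_ge_signs:
  fixes g :: "'v \<Rightarrow> real"
  assumes G: "simple_graph G" and g: "\<And>v. v \<in> vertices G \<Longrightarrow> g v = 1 \<or> g v = -1"
  shows "surplus G \<ge> - (\<Sum>e\<in>edges G. \<Prod>w\<in>e. g w) / 2"
proof -
  define B where "B = (vertices G, {e\<in>edges G. (\<Prod>w\<in>e. g w) = -1})"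
  have pm: "(\<Prod>w\<in>e. g w) = 1 \<or> (\<Prod>w\<in>e. g w) = -1" if e: "e \<in> edges G" for e
  proof -
    obtain u v where uv: "e = {u, v}" "u \<noteq> v" "u \<in> vertices G" "v \<in> vertices G"
      using simple_edge[OF G e] .
    then show ?thesis using g[OF uv(3)] g[OF uv(4)] by auto
  qed
  have B: "is_subgraph B G"
    using G by (auto simp: B_def is_subgraph_def simple_graph_def)
  have "bipartite_graph B"
    unfolding bipartite_graph_def
  proof (intro exI conjI ballI)
    let ?X = "{v\<in>vertices G. g v = 1}" and ?Y = "{v\<in>vertices G. g v = -1}"
    show "?X \<union> ?Y = vertices B" "?X \<inter> ?Y = {}"
      using g by (auto simp: B_def)
    fix e assume "e \<in> edges B"
    then have e: "e \<in> edges G" "(\<Prod>w\<in>e. g w) = -1" by (auto simp: B_def)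
    obtain u v where uv: "e = {u, v}" "u \<noteq> v" "u \<in> vertices G" "v \<in> vertices G"
      using simple_edge[OF G e(1)] .
    then have "g u * g v = -1" using e(2) by simp
    then have "g u = 1 \<and> g v = -1 \<or> g u = -1 \<and> g v = 1"
      using g[OF uv(3)] g[OF uv(4)] by auto
    then show "\<exists>x\<in>?X. \<exists>y\<in>?Y. e = {x, y}"
      using uv by (auto simp: insert_commute)
  qed
  have "finite {card (edges B) | B. is_subgraph B G \<and> bipartite_graph B}"
    by (rule finite_subset[of _ "{..card (edges G)}"])
      (use card_mono[OF finite_edges[OF G]] in \<open>auto simp: is_subgraph_def\<close>)
  then have "card (edges B) \<le> mc G"
    unfolding mc_def using B \<open>bipartite_graph B\<close> by (intro Max_ge) blast+
  moreover have "real (card (edges B)) = (\<Sum>e\<in>edges G. (1 - (\<Prod>w\<in>e. g w)) / 2)"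
  proof -
    have "(\<Sum>e\<in>edges G. (1 - (\<Prod>w\<in>e. g w)) / 2) = (\<Sum>e\<in>edges G. if (\<Prod>w\<in>e. g w) = -1 then 1 else 0)"
      using pm by (intro sum.cong) auto
    then show ?thesis
      using finite_edges[OF G] by (simp add: sum.If_cases B_def Int_def)
  qed
  moreover have "(\<Sum>e\<in>edges G. (1 - (\<Prod>w\<in>e. g w)) / 2) =
      card (edges G) / 2 - (\<Sum>e\<in>edges G. \<Prod>w\<in>e. g w) / 2"
    by (simp add: sum_subtractf diff_divide_distrib flip: sum_divide_distrib)
  ultimately show ?thesis
    by (simp add: surplus_def)
qed

text \<open>Randomness is modelled by uniform averages over a finite set. Each outcome can be
  rounded to signs on its own, so its edge sum is at least minus twice the surplus, and so is the
  average.\<close>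

lemma surplus_ge_average:
  fixes f :: "'o \<Rightarrow> 'v \<Rightarrow> real"
  assumes G: "simple_graph G" and \<Omega>: "finite \<Omega>" "\<Omega> \<noteq> {}"
    and f: "\<And>\<omega> v. \<omega> \<in> \<Omega> \<Longrightarrow> \<bar>f \<omega> v\<bar> \<le> 1"
  shows "surplus G \<ge> - (\<Sum>e\<in>edges G. (\<Sum>\<omega>\<in>\<Omega>. \<Prod>w\<in>e. f \<omega> w) / card \<Omega>) / 2"
proof -
  have fin: "finite (vertices G)" using G by (simp add: simple_graph_def)
  have "- (2 * surplus G) \<le> (\<Sum>e\<in>edges G. \<Prod>w\<in>e. f \<omega> w)" if \<omega>: "\<omega> \<in> \<Omega>" for \<omega>
  proof -
    obtain g where "\<forall>v\<in>vertices G. g v = 1 \<or> g v = -1"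
      "(\<Sum>e\<in>edges G. \<Prod>w\<in>e. g w) \<le> (\<Sum>e\<in>edges G. \<Prod>w\<in>e. f \<omega> w)"
      using multilinear_rounding[where f = "f \<omega>", OF finite_edges[OF G] finite_edge[OF G] fin f[OF \<omega>]]
      by auto
    then show ?thesis
      using surplus_ge_signs[OF G, of g] by force
  qed
  then have "real (card \<Omega>) * (- (2 * surplus G)) \<le> (\<Sum>\<omega>\<in>\<Omega>. \<Sum>e\<in>edges G. \<Prod>w\<in>e. f \<omega> w)"
    by (intro sum_bounded_below) auto
  also have "\<dots> = (\<Sum>e\<in>edges G. \<Sum>\<omega>\<in>\<Omega>. \<Prod>w\<in>e. f \<omega> w)"
    by (rule sum.swap)
  finally show ?thesis
    using \<Omega> by (simp add: field_simps card_gt_0_iff flip: sum_divide_distrib)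
qed

section \<open>Forests in neighbourhoods\<close>

definition nbhd :: "'v ugraph \<Rightarrow> 'v \<Rightarrow> 'v set" where
  "nbhd G v = {u. {u, v} \<in> edges G}"

lemma nbhd_sym: "u \<in> nbhd G v \<longleftrightarrow> v \<in> nbhd G u"
  by (auto simp: nbhd_def insert_commute)

lemma nbhd_irrefl: "simple_graph G \<Longrightarrow> v \<notin> nbhd G v"
  by (auto simp: nbhd_def simple_graph_def)

lemma nbhd_subset: "simple_graph G \<Longrightarrow> nbhd G v \<subseteq> vertices G"
  by (auto simp: nbhd_def simple_graph_def)

lemma finite_nbhd: "simple_graph G \<Longrightarrow> finite (nbhd G v)"
  using nbhd_subset finite_subset simple_graph_def by metis

lemma simple_delete_vertex: "simple_graph G \<Longrightarrow> simple_graph (delete_vertex G v)"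
  by (auto simp: simple_graph_def delete_vertex_def)

lemma acyclic_delete_vertex: "acyclic_graph G \<Longrightarrow> acyclic_graph (delete_vertex G v)"
  by (fastforce simp: acyclic_graph_def graph_cycle_def delete_vertex_def)

text \<open>If all degrees were at least 2, the first vertex of a longest path would have a
  neighbour other than its successor. By maximality this neighbour lies on the path, which closes a
  cycle.\<close>

lemma acyclic_has_leaf:
  assumes G: "simple_graph G" "acyclic_graph G" "vertices G \<noteq> {}"
  shows "\<exists>v\<in>vertices G. card (nbhd G v) \<le> 1"
proof (rule ccontr)
  assume "\<not> ?thesis"
  then have deg: "card (nbhd G v) \<ge> 2" if "v \<in> vertices G" for v
    using that by force
  define path where "path p \<longleftrightarrow> p \<noteq> [] \<and> distinct p \<and> set p \<subseteq> vertices G \<and>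
    (\<forall>i. Suc i < length p \<longrightarrow> {p ! i, p ! Suc i} \<in> edges G)" for p
  have fin: "finite (vertices G)" using G by (simp add: simple_graph_def)
  obtain x where "x \<in> vertices G" using G(3) by auto
  then have "path [x]" by (simp add: path_def)
  moreover have "\<forall>p. path p \<longrightarrow> length p < Suc (card (vertices G))"
    using fin by (auto simp: path_def less_Suc_eq_le card_mono simp flip: distinct_card)
  ultimately obtain p where p: "path p" "\<And>q. path q \<Longrightarrow> length q \<le> length p"
    using ex_has_greatest_nat[of path "[x]" length] by blast
  then obtain y ys where p_eq: "p = y # ys" by (cases p) (auto simp: path_def)
  \<comment> \<open>On a path with one vertex \<open>p ! 1\<close> is unspecified, but removing any
    single value from two neighbours leaves one, so no case distinction arises.\<close>
  have "card (nbhd G y - {p ! 1}) \<ge> 1"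
    using deg[of y] p(1) finite_nbhd[OF G(1), of y] unfolding path_def p_eq
    by (auto simp: card_Diff_singleton_if)
  then obtain z where z: "z \<in> nbhd G y" "z \<noteq> p ! 1"
    by (metis Diff_iff all_not_in_conv card.empty insertI1 not_one_le_zero)
  have "z \<in> set p"
  proof (rule ccontr)
    assume "z \<notin> set p"
    have "path (z # p)"
      unfolding path_def
    proof (intro conjI allI impI)
      show "distinct (z # p)" "set (z # p) \<subseteq> vertices G"
        using p(1) \<open>z \<notin> set p\<close> z(1) nbhd_subset[OF G(1)] by (auto simp: path_def)
      fix i assume "Suc i < length (z # p)"
      then show "{(z # p) ! i, (z # p) ! Suc i} \<in> edges G"
        using p(1) z(1) by (cases i) (auto simp: path_def p_eq nbhd_def)
    qed simp
    with p(2) show False by fastforce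
  qed
  then obtain j where j: "j < length p" "p ! j = z" by (auto simp: in_set_conv_nth)
  have "j \<noteq> 0" using j z(1) nbhd_irrefl[OF G(1), of y] by (metis nth_Cons_0 p_eq)
  moreover have "j \<noteq> 1" using j z(2) by auto
  ultimately have "j \<ge> 2" by simp
  \<comment> \<open>The edge from \<open>z\<close> back to \<open>y\<close> closes this initial
    segment; \<open>j \<ge> 2\<close> gives the required three vertices.\<close>
  have "graph_cycle G (take (Suc j) p)"
    unfolding graph_cycle_def
  proof (intro conjI allI impI)
    show "3 \<le> length (take (Suc j) p)" using \<open>j \<ge> 2\<close> j by simp
    show "distinct (take (Suc j) p)" "set (take (Suc j) p) \<subseteq> vertices G"
      using p(1) set_take_subset[of "Suc j" p] by (auto simp: path_def)
    fix i assume "i < length (take (Suc j) p)"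
    then have i: "i \<le> j" "length (take (Suc j) p) = Suc j" using j by auto
    show "{take (Suc j) p ! i, take (Suc j) p ! (Suc i mod length (take (Suc j) p))} \<in> edges G"
    proof (cases "i = j")
      case True
      have "take (Suc j) p ! j = z" "take (Suc j) p ! 0 = y" using j by (simp, simp add: p_eq)
      then show ?thesis using i z(1) True by (simp add: nbhd_def)
    next
      case False
      then show ?thesis using i j p(1) by (simp add: path_def)
    qed
  qed
  with G(2) show False by (auto simp: acyclic_graph_def)
qed

lemma forest_embedding:
  assumes "simple_graph F" "acyclic_graph F" "simple_graph G" "A \<noteq> {}" "A \<subseteq> vertices G"
    and "\<And>a. a \<in> A \<Longrightarrow> card (nbhd G a \<inter> A) \<ge> card (vertices F)"
  shows "\<exists>\<phi>. inj_on \<phi> (vertices F) \<and> \<phi> ` vertices F \<subseteq> A \<and>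
    (\<forall>u v. {u, v} \<in> edges F \<longrightarrow> {\<phi> u, \<phi> v} \<in> edges G)"
  using assms(1,2,6)
proof (induction "card (vertices F)" arbitrary: F)
  case 0
  then have "vertices F = {}" by (simp add: simple_graph_def)
  with 0 have "edges F = {}" by (fastforce simp: simple_graph_def)
  with \<open>vertices F = {}\<close> show ?case by auto
next
  case (Suc n)
  have fin: "finite (vertices F)" "finite A"
    using Suc.prems(1) assms(3,5) by (auto simp: simple_graph_def intro: finite_subset)
  have "vertices F \<noteq> {}" using Suc(2) by auto
  then obtain v where v: "v \<in> vertices F" "card (nbhd F v) \<le> 1"
    using acyclic_has_leaf Suc.prems by blast
  let ?F = "delete_vertex F v"
  have VF: "vertices ?F = vertices F - {v}" by (simp add: delete_vertex_def)
  have card: "card (vertices ?F) = n"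
    using v Suc(2) by (simp add: VF)
  have "\<exists>\<phi>. inj_on \<phi> (vertices ?F) \<and> \<phi> ` vertices ?F \<subseteq> A \<and>
    (\<forall>u v. {u, v} \<in> edges ?F \<longrightarrow> {\<phi> u, \<phi> v} \<in> edges G)"
  proof (rule Suc(1))
    show "n = card (vertices ?F)" using card by simp
    show "card (vertices ?F) \<le> card (nbhd G a \<inter> A)" if "a \<in> A" for a
      using Suc.prems(3)[OF that] Suc(2) card by simp
  qed (use Suc.prems in \<open>auto intro: simple_delete_vertex acyclic_delete_vertex\<close>)
  then obtain \<phi> where \<phi>: "inj_on \<phi> (vertices ?F)" "\<phi> ` vertices ?F \<subseteq> A"
    "\<And>u v. {u, v} \<in> edges ?F \<Longrightarrow> {\<phi> u, \<phi> v} \<in> edges G"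
    by blast
  have im: "card (\<phi> ` vertices ?F) = n" using card \<phi>(1) by (simp add: card_image)
  have free: "\<exists>b. b \<in> B - \<phi> ` vertices ?F" if "B \<subseteq> A" "card B \<ge> Suc n" for B
  proof -
    have "\<not> B \<subseteq> \<phi> ` vertices ?F"
      using card_mono[of "\<phi> ` vertices ?F" B] fin(1) im that by (auto simp: VF)
    then show ?thesis by blast
  qed
  obtain b where b: "b \<in> A" "b \<notin> \<phi> ` vertices ?F" "\<And>w. w \<in> nbhd F v \<Longrightarrow> b \<in> nbhd G (\<phi> w)"
  proof (cases "nbhd F v = {}")
    \<comment> \<open>An isolated vertex may go anywhere in \<open>A\<close>, which is large enough
      since it contains many neighbours of any of its elements.\<close>
    case True
    obtain a where a: "a \<in> A" using assms(4) by auto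
    then have "card A \<ge> Suc n"
      using Suc.prems(3)[OF a] Suc(2) card_mono[OF fin(2), of "nbhd G a \<inter> A"] by simp
    then show ?thesis using free[of A] True that by blast
  next
    case False
    then have "card (nbhd F v) = 1"
      using v(2) finite_nbhd[OF Suc.prems(1)] by (simp add: le_Suc_eq)
    then obtain w where w: "nbhd F v = {w}" by (auto simp: card_1_singleton_iff)
    then have "w \<in> vertices ?F"
      using nbhd_subset[OF Suc.prems(1), of v] nbhd_irrefl[OF Suc.prems(1), of v] by (auto simp: VF)
    then have "\<phi> w \<in> A" using \<phi>(2) by auto
    then show ?thesis
      using free[of "nbhd G (\<phi> w) \<inter> A"] Suc.prems(3) Suc(2) w that by (metis DiffD1 DiffD2 IntD1 IntD2 Int_lower2 singletonD)
  qed
  let ?\<psi> = "\<phi>(v := b)"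
  have "inj_on ?\<psi> (vertices F)"
    using \<phi>(1) b(2) unfolding VF by (auto simp: inj_on_def)
  moreover have "?\<psi> ` vertices F \<subseteq> A"
    using \<phi>(2) b(1) unfolding VF by auto
  moreover have "{?\<psi> x, ?\<psi> y} \<in> edges G" if xy: "{x, y} \<in> edges F" for x y
  proof -
    have "x \<noteq> y" using xy Suc.prems(1) by (auto simp: simple_graph_def)
    consider "x = v" | "y = v" | "x \<noteq> v" "y \<noteq> v" by auto
    then show ?thesis
    proof cases
      case 1
      then have "y \<in> nbhd F v" using xy by (simp add: nbhd_def insert_commute)
      then show ?thesis using b(3)[of y] 1 \<open>x \<noteq> y\<close> by (simp add: nbhd_def insert_commute)
    next
      case 2
      then have "x \<in> nbhd F v" using xy by (simp add: nbhd_def insert_commute)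
      then show ?thesis using b(3)[of x] 2 \<open>x \<noteq> y\<close> by (simp add: nbhd_def insert_commute)
    next
      case 3
      then show ?thesis using xy \<phi>(3)[of x y] by (simp add: delete_vertex_def)
    qed
  qed
  ultimately show ?case by blast
qed

lemma embedding_not_free:
  assumes H: "simple_graph H" and inj: "inj_on \<phi> (vertices H)"
    and into: "\<phi> ` vertices H \<subseteq> vertices G"
    and edges: "\<And>u v. {u, v} \<in> edges H \<Longrightarrow> {\<phi> u, \<phi> v} \<in> edges G"
  shows "\<not> graph_free H G"
proof -
  \<comment> \<open>The copy keeps only the images of edges of \<open>H\<close>:
    \<open>graph_isomorphic\<close> demands an equivalence, which further edges of \<open>G\<close>
    between image vertices would violate.\<close>
  let ?K = "(\<phi> ` vertices H, (`) \<phi> ` edges H)"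
  have sub: "e \<subseteq> vertices H" "card e = 2" if "e \<in> edges H" for e
    using H that by (auto simp: simple_graph_def)
  have "\<phi> ` e \<in> edges G" if e: "e \<in> edges H" for e
  proof -
    obtain u v where "e = {u, v}" using simple_edge[OF H e] by blast
    with edges e show ?thesis by simp
  qed
  moreover have "card (\<phi> ` e) = 2" if "e \<in> edges H" for e
    using sub[OF that] card_image[OF inj_on_subset[OF inj]] by simp
  moreover have "\<phi> ` e \<subseteq> \<phi> ` vertices H" if "e \<in> edges H" for e
    using sub(1)[OF that] by (rule image_mono)
  ultimately have "is_subgraph ?K G"
    using H into unfolding is_subgraph_def simple_graph_def by auto
  moreover have "graph_isomorphic H ?K"
    unfolding graph_isomorphic_def
  proof (intro exI conjI ballI)
    show "bij_betw \<phi> (vertices H) (vertices ?K)"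
      using inj by (simp add: bij_betw_def)
    fix u v assume uv: "u \<in> vertices H" "v \<in> vertices H"
    show "{u, v} \<in> edges H \<longleftrightarrow> {\<phi> u, \<phi> v} \<in> edges ?K"
    proof
      assume "{\<phi> u, \<phi> v} \<in> edges ?K"
      then obtain e where e: "e \<in> edges H" "\<phi> ` e = \<phi> ` {u, v}" by auto
      then have "e = {u, v}"
        using inj_on_image_eq_iff[OF inj sub(1)[OF e(1)], of "{u, v}"] uv by simp
      with e show "{u, v} \<in> edges H" by simp
    next
      assume "{u, v} \<in> edges H"
      then have "\<phi> ` {u, v} \<in> edges ?K" unfolding snd_conv by (rule imageI)
      then show "{\<phi> u, \<phi> v} \<in> edges ?K" by simp
    qed
  qed
  ultimately show ?thesis unfolding graph_free_def by blast
qed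

text \<open>If every vertex of \<open>A\<close> had at least \<open>card (vertices H)\<close>
  neighbours in \<open>A\<close>, the forest \<open>delete_vertex H z\<close> would embed into
  \<open>A\<close>, and \<open>x\<close>, adjacent to all of \<open>A\<close>, would complete a copy
  of \<open>H\<close>. So some vertex has fewer; peeling it off loses few edges, and induction on
  \<open>card A\<close> applies.\<close>

lemma locally_sparse:
  assumes H: "simple_graph H" "z \<in> vertices H" "acyclic_graph (delete_vertex H z)"
    and G: "simple_graph G" "graph_free H G" and A: "A \<subseteq> nbhd G x"
  shows "card {e\<in>edges G. e \<subseteq> A} \<le> card (vertices H) * card A"
proof -
  have "finite A" using A finite_nbhd[OF G(1)] finite_subset by blast
  then show ?thesis using A
  proof (induction "card A" arbitrary: A)
    case 0
    then have "{e\<in>edges G. e \<subseteq> A} = {}" using G(1) by (fastforce simp: simple_graph_def)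
    then show ?case by (metis card.empty zero_le)
  next
    case (Suc n)
    let ?h = "card (vertices H)"
    let ?F = "delete_vertex H z"
    have VF: "vertices ?F = vertices H - {z}" by (simp add: delete_vertex_def)
    have AV: "A \<subseteq> vertices G" using Suc.prems nbhd_subset[OF G(1)] by blast
    have "\<exists>a\<in>A. card (nbhd G a \<inter> A) < ?h"
    proof (rule ccontr)
      assume "\<not> ?thesis"
      then have large: "card (nbhd G a \<inter> A) \<ge> card (vertices ?F)" if "a \<in> A" for a
        using that H(1,2) VF by (force simp: simple_graph_def)
      have "A \<noteq> {}" using Suc(2) by auto
      obtain \<phi> where \<phi>: "inj_on \<phi> (vertices ?F)" "\<phi> ` vertices ?F \<subseteq> A"
        "\<And>u v. {u, v} \<in> edges ?F \<Longrightarrow> {\<phi> u, \<phi> v} \<in> edges G"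
        using forest_embedding[OF simple_delete_vertex[OF H(1)] H(3) G(1) \<open>A \<noteq> {}\<close> AV large]
        by blast
      have "\<phi> ` vertices ?F \<subseteq> nbhd G x" using \<phi>(2) Suc.prems by blast
      then have adj: "{\<phi> u, x} \<in> edges G" if "u \<in> vertices H" "u \<noteq> z" for u
        using that by (auto simp: VF nbhd_def)
      \<comment> \<open>The common neighbour \<open>x\<close> takes the role of the removed vertex
        \<open>z\<close>.\<close>
      let ?\<psi> = "\<phi>(z := x)"
      have "x \<in> vertices G"
      proof -
        obtain a where "a \<in> nbhd G x" using \<open>A \<noteq> {}\<close> Suc.prems(2) by blast
        then have "x \<in> nbhd G a" by (simp add: nbhd_sym[of x])
        then show ?thesis using nbhd_subset[OF G(1)] by blast
      qed
      have "\<not> graph_free H G"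
      proof (rule embedding_not_free[OF H(1)])
        show "inj_on ?\<psi> (vertices H)"
        proof -
          have "\<phi> u \<noteq> x" if "u \<in> vertices H" "u \<noteq> z" for u
            using adj[OF that] G(1) by (auto simp: simple_graph_def)
          then show ?thesis using \<phi>(1) unfolding VF inj_on_def by auto
        qed
        show "?\<psi> ` vertices H \<subseteq> vertices G"
          using \<phi>(2) AV \<open>x \<in> vertices G\<close> unfolding VF by auto
        fix u v assume uv: "{u, v} \<in> edges H"
        then have "u \<in> vertices H" "v \<in> vertices H" "u \<noteq> v"
          using H(1) by (auto simp: simple_graph_def)
        then show "{?\<psi> u, ?\<psi> v} \<in> edges G"
          using adj[of u] adj[of v] \<phi>(3)[of u v] uv by (auto simp: delete_vertex_def insert_commute)
      qed
      with G(2) show False by simp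
    qed
    then obtain a where a: "a \<in> A" "card (nbhd G a \<inter> A) < ?h" by blast
    have "{e\<in>edges G. e \<subseteq> A} \<subseteq> {e\<in>edges G. e \<subseteq> A - {a}} \<union> (\<lambda>b. {b, a}) ` (nbhd G a \<inter> A)"
    proof
      fix e assume e: "e \<in> {e\<in>edges G. e \<subseteq> A}"
      then obtain u v where uv: "e = {u, v}" using simple_edge[OF G(1), of e] by blast
      then show "e \<in> {e\<in>edges G. e \<subseteq> A - {a}} \<union> (\<lambda>b. {b, a}) ` (nbhd G a \<inter> A)"
        using e by (cases "a = u"; cases "a = v") (auto simp: nbhd_def insert_commute)
    qed
    then have "card {e\<in>edges G. e \<subseteq> A} \<le>
        card ({e\<in>edges G. e \<subseteq> A - {a}} \<union> (\<lambda>b. {b, a}) ` (nbhd G a \<inter> A))"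
      using finite_edges[OF G(1)] Suc.prems by (intro card_mono) auto
    also have "\<dots> \<le> card {e\<in>edges G. e \<subseteq> A - {a}} + card (nbhd G a \<inter> A)"
      using card_Un_le[of "{e\<in>edges G. e \<subseteq> A - {a}}" "(\<lambda>b. {b, a}) ` (nbhd G a \<inter> A)"]
        card_image_le[of "nbhd G a \<inter> A" "\<lambda>b. {b, a}"] Suc.prems(1) by simp
    also have "\<dots> \<le> ?h * n + ?h"
    proof (rule add_mono)
      have "card (A - {a}) = n" using Suc(2) Suc.prems(1) a(1) by simp
      then show "card {e\<in>edges G. e \<subseteq> A - {a}} \<le> ?h * n"
        using Suc(1)[of "A - {a}"] Suc.prems by auto
    qed (use a in simp)
    also have "\<dots> = ?h * card A" unfolding Suc(2)[symmetric] by simp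
    finally show ?case .
  qed
qed

section \<open>Counting edges\<close>

lemma sum_card_nbhd:
  assumes G: "simple_graph G"
  shows "(\<Sum>v\<in>vertices G. card (nbhd G v)) = 2 * card (edges G)"
proof -
  have "card (nbhd G v) = card {e\<in>edges G. v \<in> e}" for v
  proof (rule bij_betw_same_card[of "\<lambda>u. {u, v}"], unfold bij_betw_def, intro conjI)
    show "inj_on (\<lambda>u. {u, v}) (nbhd G v)"
      by (auto simp: inj_on_def doubleton_eq_iff)
    show "(\<lambda>u. {u, v}) ` nbhd G v = {e\<in>edges G. v \<in> e}"
    proof (intro subset_antisym subsetI)
      fix e assume e: "e \<in> {e\<in>edges G. v \<in> e}"
      then obtain u w where "e = {u, w}" using simple_edge[OF G, of e] by blast
      then have "e = {u, v} \<or> e = {w, v}" using e by auto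
      then show "e \<in> (\<lambda>u. {u, v}) ` nbhd G v" using e by (auto simp: nbhd_def)
    qed (auto simp: nbhd_def)
  qed
  then have "(\<Sum>v\<in>vertices G. card (nbhd G v)) = (\<Sum>v\<in>vertices G. card {e\<in>edges G. v \<in> e})"
    by simp
  also have "\<dots> = (\<Sum>e\<in>edges G. 2)"
  proof (rule sum_multicount_gen)
    show "\<forall>e\<in>edges G. card {v\<in>vertices G. v \<in> e} = 2"
    proof
      fix e assume "e \<in> edges G"
      then have "card e = 2" "{v\<in>vertices G. v \<in> e} = e" using G by (auto simp: simple_graph_def)
      then show "card {v\<in>vertices G. v \<in> e} = 2" by simp
    qed
  qed (use G finite_edges[OF G] in \<open>auto simp: simple_graph_def\<close>)
  finally show ?thesis by simp
qed

lemma common_nbrs_le: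
  assumes G: "simple_graph G"
    and sparse: "\<And>x A. A \<subseteq> nbhd G x \<Longrightarrow> card {e\<in>edges G. e \<subseteq> A} \<le> h * card A"
    and S: "\<And>v. S v \<subseteq> nbhd G v"
  shows "(\<Sum>e\<in>edges G. card (\<Inter>(S ` e))) \<le> 2 * h * card (edges G)"
proof -
  have "(\<Sum>e\<in>edges G. card (\<Inter>(S ` e))) = (\<Sum>e\<in>edges G. card {x\<in>vertices G. \<forall>v\<in>e. x \<in> S v})"
  proof (intro sum.cong refl arg_cong[of _ _ card])
    fix e assume "e \<in> edges G"
    \<comment> \<open>An empty edge would make the intersection the whole type.\<close>
    then have "e \<noteq> {}" using G by (auto simp: simple_graph_def)
    then show "\<Inter>(S ` e) = {x\<in>vertices G. \<forall>v\<in>e. x \<in> S v}"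
      using S nbhd_subset[OF G] by blast
  qed
  also have "\<dots> = (\<Sum>x\<in>vertices G. card {e\<in>edges G. \<forall>v\<in>e. x \<in> S v})"
    using G finite_edges[OF G] by (intro sum_multicount_gen) (auto simp: simple_graph_def)
  also have "\<dots> \<le> (\<Sum>x\<in>vertices G. h * card (nbhd G x))"
  proof (rule sum_mono)
    fix x
    have "{e\<in>edges G. \<forall>v\<in>e. x \<in> S v} \<subseteq> {e\<in>edges G. e \<subseteq> nbhd G x}"
      using S nbhd_sym[of x G] by blast
    then have "card {e\<in>edges G. \<forall>v\<in>e. x \<in> S v} \<le> card {e\<in>edges G. e \<subseteq> nbhd G x}"
      using finite_edges[OF G] by (intro card_mono) auto
    also have "\<dots> \<le> h * card (nbhd G x)" by (rule sparse[OF subset_refl])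
    finally show "card {e\<in>edges G. \<forall>v\<in>e. x \<in> S v} \<le> h * card (nbhd G x)" .
  qed
  also have "\<dots> = 2 * h * card (edges G)"
    using sum_card_nbhd[OF G] by (simp add: sum_distrib_left[symmetric])
  finally show ?thesis .
qed

section \<open>Induced subgraphs\<close>

definition induced :: "'v ugraph \<Rightarrow> 'v set \<Rightarrow> 'v ugraph" where
  "induced G U = (U, {e\<in>edges G. e \<subseteq> U})"

lemma is_subgraph_induced: "simple_graph G \<Longrightarrow> U \<subseteq> vertices G \<Longrightarrow> is_subgraph (induced G U) G"
  using finite_subset[of U "vertices G"] by (auto simp: is_subgraph_def induced_def simple_graph_def)

lemma nbhd_induced: "v \<in> U \<Longrightarrow> nbhd (induced G U) v = nbhd G v \<inter> U"
  by (auto simp: nbhd_def induced_def)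

lemma graph_free_subgraph: "graph_free H G \<Longrightarrow> is_subgraph K G \<Longrightarrow> graph_free H K"
proof -
  assume "graph_free H G" "is_subgraph K G"
  moreover have "is_subgraph L K \<Longrightarrow> is_subgraph L G" for L
    using \<open>is_subgraph K G\<close> by (auto simp: is_subgraph_def)
  ultimately show "graph_free H K"
    unfolding graph_free_def by metis
qed

text \<open>An optimal cut of the induced subgraph extends fractionally by 0 outside
  \<open>U\<close>. Edges not contained in \<open>U\<close> then contribute nothing, and rounding
  yields a genuine cut of \<open>G\<close>.\<close>

lemma surplus_induced_le:
  assumes G: "simple_graph G" and U: "U \<subseteq> vertices G"
  shows "surplus (induced G U) \<le> surplus G"
proof -
  let ?E = "{e\<in>edges G. e \<subseteq> U}"
  have "simple_graph (induced G U)"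
    using is_subgraph_induced[OF assms] by (simp add: is_subgraph_def)
  then obtain B where B: "is_subgraph B (induced G U)" "bipartite_graph B"
    "card (edges B) = mc (induced G U)"
    using mc_attained by blast
  from B(2) obtain X Y where "X \<union> Y = vertices B \<and> X \<inter> Y = {} \<and>
      (\<forall>e\<in>edges B. \<exists>x\<in>X. \<exists>y\<in>Y. e = {x, y})"
    unfolding bipartite_graph_def by (elim exE)
  then have XY: "X \<union> Y = vertices B" "X \<inter> Y = {}"
    "\<And>e. e \<in> edges B \<Longrightarrow> \<exists>x\<in>X. \<exists>y\<in>Y. e = {x, y}"
    by simp_all
  have BU: "vertices B \<subseteq> U" "edges B \<subseteq> ?E"
    using B(1) by (auto simp: is_subgraph_def induced_def)
  \<comment> \<open>The function is deterministic, hence the one-point sample space. Vertices of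
    \<open>U\<close> missing from \<open>B\<close> are put on the side of \<open>Y\<close>.\<close>
  define f :: "unit \<Rightarrow> 'a \<Rightarrow> real" where
    "f \<omega> v = (if v \<in> X then 1 else if v \<in> U then -1 else 0)" for \<omega> v
  have fin: "finite (edges G)" using finite_edges[OF G] .
  have f_le: "\<bar>\<Prod>w\<in>e. f () w\<bar> \<le> 1" for e
    unfolding abs_prod by (intro prod_le_1) (auto simp: f_def)
  have "(\<Sum>e\<in>edges G. \<Prod>w\<in>e. f () w) = (\<Sum>e\<in>?E. \<Prod>w\<in>e. f () w)"
  proof (intro sum.mono_neutral_right ballI)
    fix e assume e: "e \<in> edges G - ?E"
    then obtain w where "w \<in> e" "w \<notin> U" by auto
    moreover have "f () w = 0" using \<open>w \<notin> U\<close> XY(1) BU(1) by (auto simp: f_def)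
    ultimately show "(\<Prod>w\<in>e. f () w) = 0"
      using e finite_edge[OF G] by (intro prod_zero) auto
  qed (use fin in auto)
  also have "\<dots> \<le> (\<Sum>e\<in>?E. 1 - 2 * (if e \<in> edges B then 1 else 0))"
  proof (rule sum_mono)
    fix e assume "e \<in> ?E"
    show "(\<Prod>w\<in>e. f () w) \<le> 1 - 2 * (if e \<in> edges B then 1 else 0)"
    proof (cases "e \<in> edges B")
      case True
      then obtain x y where xy: "x \<in> X" "y \<in> Y" "e = {x, y}" using XY(3) by blast
      then have "x \<noteq> y" "y \<notin> X" "y \<in> U" using XY(1,2) BU(1) by auto
      then show ?thesis using xy True by (simp add: f_def)
    next
      case False
      then show ?thesis using f_le[of e] by simp
    qed
  qed
  also have "\<dots> = card ?E - 2 * real (card (edges B))"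
  proof -
    have "?E \<inter> edges B = edges B" using BU(2) by auto
    then show ?thesis using fin by (simp add: sum_subtractf sum_distrib_left[symmetric] sum.If_cases)
  qed
  finally have "(\<Sum>e\<in>edges G. \<Prod>w\<in>e. f () w) \<le> card ?E - 2 * real (card (edges B))" .
  moreover have "surplus G \<ge> - (\<Sum>e\<in>edges G. \<Prod>w\<in>e. f () w) / 2"
    using surplus_ge_average[OF G, of "{()}" f] by (simp add: f_def)
  ultimately show ?thesis
    unfolding surplus_def[of "induced G U"] B(3) by (simp add: induced_def)
qed

section \<open>Random signs and the sparse case\<close>

text \<open>\<open>T\<close> records the coordinates with sign 1, so summing over
  \<open>Pow A\<close> amounts to averaging over independent fair signs. Each sign contributes
  \<open>cos (c + a x) + cos (c - a x) = 2 * cos c * cos (a x)\<close>; the offset \<open>c\<close>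
  is arbitrary so that the induction can absorb \<open>a x\<close> into it.\<close>

lemma sum_Pow_cos:
  fixes a :: "'v \<Rightarrow> real"
  assumes "finite A"
  shows "(\<Sum>T\<in>Pow A. cos (c + (\<Sum>i\<in>A. if i \<in> T then a i else - a i))) =
    2 ^ card A * cos c * (\<Prod>i\<in>A. cos (a i))"
  using assms
proof (induction A arbitrary: c)
  case empty
  then show ?case by simp
next
  case (insert x A)
  let ?s = "\<lambda>T. \<Sum>i\<in>A. if i \<in> T then a i else - a i"
  have inj: "inj_on (insert x) (Pow A)"
    using insert(2) by (auto simp: inj_on_def)
  have "(\<Sum>T\<in>Pow (insert x A). cos (c + (\<Sum>i\<in>insert x A. if i \<in> T then a i else - a i))) =
      (\<Sum>T\<in>Pow A. cos (c + (\<Sum>i\<in>insert x A. if i \<in> T then a i else - a i))) +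
      (\<Sum>T\<in>Pow A. cos (c + (\<Sum>i\<in>insert x A. if i \<in> insert x T then a i else - a i)))"
    unfolding Pow_insert using insert(1,2)
    by (subst sum.union_disjoint) (auto simp: sum.reindex[OF inj])
  also have "(\<Sum>T\<in>Pow A. cos (c + (\<Sum>i\<in>insert x A. if i \<in> T then a i else - a i))) =
      (\<Sum>T\<in>Pow A. cos ((c - a x) + ?s T))"
    using insert(1,2) by (intro sum.cong arg_cong[of _ _ cos]) auto
  also have "(\<Sum>T\<in>Pow A. cos (c + (\<Sum>i\<in>insert x A. if i \<in> insert x T then a i else - a i))) =
      (\<Sum>T\<in>Pow A. cos ((c + a x) + ?s T))"
  proof (intro sum.cong arg_cong[of _ _ cos] refl)
    fix T
    have "(\<Sum>i\<in>A. if i \<in> insert x T then a i else - a i) = ?s T"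
      using insert(2) by (intro sum.cong) auto
    then show "c + (\<Sum>i\<in>insert x A. if i \<in> insert x T then a i else - a i) = (c + a x) + ?s T"
      using insert(1,2) by simp
  qed
  also have "(\<Sum>T\<in>Pow A. cos ((c - a x) + ?s T)) + (\<Sum>T\<in>Pow A. cos ((c + a x) + ?s T)) =
      2 ^ card A * cos (c - a x) * (\<Prod>i\<in>A. cos (a i)) +
      2 ^ card A * cos (c + a x) * (\<Prod>i\<in>A. cos (a i))"
    by (simp only: insert.IH)
  finally show ?case
    using insert(1,2) by (simp add: cos_add cos_diff algebra_simps)
qed

text \<open>The product-to-sum formula leaves cosines of the difference and the sum of the two
  forms, to which \<open>sum_Pow_cos\<close> applies with offset 0.\<close>

lemma sum_Pow_sin_sin:
  fixes a b :: "'v \<Rightarrow> real"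
  assumes "finite A"
  shows "(\<Sum>T\<in>Pow A. sin (\<Sum>i\<in>A. if i \<in> T then a i else - a i) *
      sin (\<Sum>i\<in>A. if i \<in> T then b i else - b i)) / card (Pow A) =
    ((\<Prod>i\<in>A. cos (a i - b i)) - (\<Prod>i\<in>A. cos (a i + b i))) / 2"
proof -
  let ?X = "\<lambda>a T. \<Sum>i\<in>A. if i \<in> T then a i else - a i"
  have "?X a T - ?X b T = 0 + ?X (\<lambda>i. a i - b i) T" "?X a T + ?X b T = 0 + ?X (\<lambda>i. a i + b i) T" for T
    by (auto simp: sum.distrib[symmetric] sum_subtractf[symmetric] intro!: sum.cong)
  then have "(\<Sum>T\<in>Pow A. sin (?X a T) * sin (?X b T)) =
      (\<Sum>T\<in>Pow A. (cos (0 + ?X (\<lambda>i. a i - b i) T) - cos (0 + ?X (\<lambda>i. a i + b i) T)) / 2)"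
    by (simp only: sin_times_sin)
  also have "\<dots> = 2 ^ card A * ((\<Prod>i\<in>A. cos (a i - b i)) - (\<Prod>i\<in>A. cos (a i + b i))) / 2"
    unfolding sum_divide_distrib[symmetric] sum_subtractf sum_Pow_cos[OF assms]
    by (simp add: algebra_simps)
  finally show ?thesis
    using assms by (simp add: card_Pow)
qed

text \<open>Evaluates the products met in \<open>sin_correlation_le\<close>: the factors at the two
  ends of an edge are special, those on two blocks are constant, and the rest equal 1.\<close>

lemma prod_two_points_and_blocks:
  fixes c1 c2 c3 c4 :: real
  assumes "finite V" "u \<in> V" "v \<in> V" "u \<noteq> v" "K \<subseteq> V" "M \<subseteq> V"
    and "\<And>i. i \<in> V \<Longrightarrow> g i = (if i = u then c1 else 1) * (if i = v then c2 else 1) *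
      (if i \<in> K then c3 else 1) * (if i \<in> M then c4 else 1)"
  shows "(\<Prod>i\<in>V. g i) = c1 * c2 * c3 ^ card K * c4 ^ card M"
proof -
  have "(\<Prod>i\<in>V. g i) = (\<Prod>i\<in>V. if i = u then c1 else 1) * (\<Prod>i\<in>V. if i = v then c2 else 1) *
      (\<Prod>i\<in>V. if i \<in> K then c3 else 1) * (\<Prod>i\<in>V. if i \<in> M then c4 else 1)"
    using assms(7) by (simp add: prod.distrib)
  also have "(\<Prod>i\<in>V. if i \<in> K then c3 else 1) = c3 ^ card K"
    using assms(1,5) by (simp add: prod.If_cases Int_absorb1)
  also have "(\<Prod>i\<in>V. if i \<in> M then c4 else 1) = c4 ^ card M"
    using assms(1,6) by (simp add: prod.If_cases Int_absorb1)
  finally show ?thesis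
    using assms(1-3) by simp
qed

text \<open>By \<open>sum_Pow_sin_sin\<close>, the left-hand side is the correlation of the sines of the random linear
  forms with coefficients \<open>a u\<close> and \<open>a v\<close>. The main term \<open>- \<alpha> / 8\<close> comes from \<open>u \<in> S v\<close>.\<close>

lemma sin_correlation_le:
  fixes \<alpha> :: real and S :: "'v \<Rightarrow> 'v set"
  assumes V: "finite V" "u \<in> V" "v \<in> V" "u \<noteq> v" "S u \<subseteq> V" "S v \<subseteq> V"
    and S: "u \<in> S v" "v \<notin> S u" "u \<notin> S u" "v \<notin> S v"
    and D: "card (S u) \<le> D" "card (S v) \<le> D" and \<alpha>: "0 < \<alpha>" "\<alpha>\<^sup>2 * (2 * real D) \<le> 1"
  defines "a \<equiv> \<lambda>v i. if i = v then pi / 4 else if i \<in> S v then - \<alpha> else 0"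
  shows "((\<Prod>i\<in>V. cos (a u i - a v i)) - (\<Prod>i\<in>V. cos (a u i + a v i))) / 2
    \<le> - \<alpha> / 8 + \<alpha>\<^sup>2 * card (S u \<inter> S v)"
proof -
  define K where "K = S u \<inter> S v"
  define M where "M = (S u \<union> S v) - K - {u, v}"
  define k where "k = card K"
  define s where "s = card M"
  have fin: "finite (S u)" "finite (S v)" using V by (auto intro: finite_subset)
  have "u \<in> S v" "finite (S v)" using S fin by auto
  then have "D \<ge> 1" using D(2) by (metis One_nat_def Suc_leI card_gt_0_iff empty_iff le_trans)
  then have "\<alpha>\<^sup>2 * 2 \<le> \<alpha>\<^sup>2 * (2 * real D)"
    by (intro mult_left_mono) auto
  with \<alpha>(2) have \<alpha>2: "2 * \<alpha>\<^sup>2 \<le> 1" by linarith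
  \<comment> \<open>Coordinate \<open>u\<close> carries \<open>pi / 4\<close> from \<open>u\<close>
    and \<open>- \<alpha>\<close> from \<open>v\<close>, whereas coordinate \<open>v\<close> carries
    only \<open>pi / 4\<close>. On \<open>K\<close> the coefficients cancel in the difference and
    double in the sum; on \<open>M\<close> just one of them is nonzero.\<close>
  have "(\<Prod>i\<in>V. cos (a u i - a v i)) =
      cos (pi / 4 + \<alpha>) * cos (pi / 4) * 1 ^ card K * cos \<alpha> ^ card M"
    using V S by (intro prod_two_points_and_blocks) (auto simp: a_def K_def M_def)
  moreover have "(\<Prod>i\<in>V. cos (a u i + a v i)) =
      cos (pi / 4 - \<alpha>) * cos (pi / 4) * cos (2 * \<alpha>) ^ card K * cos \<alpha> ^ card M"
    using V S by (intro prod_two_points_and_blocks) (auto simp: a_def K_def M_def)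
  moreover have "cos (pi / 4 + \<alpha>) = cos (pi / 4 - \<alpha>) - 2 * sin (pi / 4) * sin \<alpha>"
    by (simp add: cos_add cos_diff)
  moreover have "cos (pi / 4) * sin (pi / 4) = 1 / 2"
    by (simp add: cos_45 sin_45)
  \<comment> \<open>Separates the main term, created at coordinate \<open>u\<close>, from an error
    that vanishes when \<open>z = 1\<close>, in particular when \<open>K\<close> is empty.\<close>
  moreover have "((X - 2 * p * q) * c * 1 ^ m * y - X * c * z * y) / 2 =
      - (q * y) / 2 + (c * X * y) * (1 - z) / 2" if "c * p = 1 / 2" for X p q c y z :: real and m :: nat
  proof -
    have "(X - 2 * p * q) * c * 1 ^ m * y = X * c * y - 2 * (c * p) * (q * y)"
      by (simp add: algebra_simps)
    then show ?thesis unfolding that by (simp add: field_simps)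
  qed
  ultimately have eq: "((\<Prod>i\<in>V. cos (a u i - a v i)) - (\<Prod>i\<in>V. cos (a u i + a v i))) / 2 =
      - (sin \<alpha> * cos \<alpha> ^ s) / 2 +
      (cos (pi / 4) * cos (pi / 4 - \<alpha>) * cos \<alpha> ^ s) * (1 - cos (2 * \<alpha>) ^ k) / 2"
    unfolding k_def s_def by presburger
  have "s \<le> card (S u) + card (S v)"
  proof -
    have "M \<subseteq> S u \<union> S v" by (auto simp: M_def)
    then have "card M \<le> card (S u \<union> S v)" using fin by (intro card_mono) auto
    with card_Un_le[of "S u" "S v"] show ?thesis unfolding s_def by linarith
  qed
  then have s: "real s \<le> 2 * real D" using D by simp
  have cos_ge: "1 - x\<^sup>2 / 2 \<le> cos x" for x :: real
  proof -
    have "(2 * \<bar>sin (x / 2)\<bar>)\<^sup>2 \<le> \<bar>x\<bar>\<^sup>2"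
      using abs_sin_x_le_abs_x[of "x / 2"] by (intro power_mono) auto
    then show ?thesis
      using cos_double_sin[of "x / 2"] by (simp add: power_mult_distrib)
  qed
  \<comment> \<open>This is why \<open>\<alpha>\<close> is at most of order
    \<open>1 / sqrt D\<close>: the up to \<open>2 * D\<close> coordinates in \<open>M\<close> must
    cost only a factor 2.\<close>
  have "1 / 2 \<le> 1 - s * (\<alpha>\<^sup>2 / 2)"
    using mult_left_mono[OF s, of "\<alpha>\<^sup>2"] \<alpha>(2) by (simp add: algebra_simps)
  also have "\<dots> \<le> (1 - \<alpha>\<^sup>2 / 2) ^ s"
    using Bernoulli_inequality[of "- \<alpha>\<^sup>2 / 2" s] \<alpha>2 by simp
  also have "\<dots> \<le> cos \<alpha> ^ s"
    using cos_ge[of \<alpha>] \<alpha>2 by (intro power_mono) auto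
  finally have cos_s: "1 / 2 \<le> cos \<alpha> ^ s" .
  have "sin \<alpha> \<ge> \<alpha> / 2"
  proof -
    obtain \<xi> where \<xi>: "0 < \<xi>" "\<xi> < \<alpha>" "sin \<alpha> - sin 0 = (\<alpha> - 0) * cos \<xi>"
      using MVT2[OF \<alpha>(1), of sin cos] by (auto intro: DERIV_sin)
    have "\<xi>\<^sup>2 \<le> \<alpha>\<^sup>2" using \<xi> by (intro power_mono) auto
    then have "1 / 2 \<le> cos \<xi>" using cos_ge[of \<xi>] \<alpha>2 by linarith
    then have "\<alpha> * (1 / 2) \<le> \<alpha> * cos \<xi>" using \<alpha>(1) by (intro mult_left_mono) auto
    then show ?thesis using \<xi>(3) by simp
  qed
  then have "\<alpha> / 2 * (1 / 2) \<le> sin \<alpha> * cos \<alpha> ^ s"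
    using cos_s \<alpha>(1) by (intro mult_mono) auto
  moreover have "(cos (pi / 4) * cos (pi / 4 - \<alpha>) * cos \<alpha> ^ s) * (1 - cos (2 * \<alpha>) ^ k) \<le>
      1 * (k * (2 * \<alpha>\<^sup>2))"
  proof (intro mult_mono)
    have "\<bar>cos (pi / 4) * cos (pi / 4 - \<alpha>) * cos \<alpha> ^ s\<bar> \<le> 1"
      by (auto simp: abs_mult power_abs intro!: mult_le_one power_le_one)
    then show "cos (pi / 4) * cos (pi / 4 - \<alpha>) * cos \<alpha> ^ s \<le> 1" by simp
    have "1 - k * (2 * \<alpha>\<^sup>2) \<le> (1 - 2 * \<alpha>\<^sup>2) ^ k"
      using Bernoulli_inequality[of "- (2 * \<alpha>\<^sup>2)" k] \<alpha>2 by simp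
    also have "\<dots> \<le> cos (2 * \<alpha>) ^ k"
      using cos_ge[of "2 * \<alpha>"] \<alpha>2 by (intro power_mono) (auto simp: power_mult_distrib)
    finally show "1 - cos (2 * \<alpha>) ^ k \<le> k * (2 * \<alpha>\<^sup>2)" by simp
    have "\<bar>cos (2 * \<alpha>) ^ k\<bar> \<le> 1"
      by (auto simp: power_abs intro!: power_le_one)
    then show "0 \<le> 1 - cos (2 * \<alpha>) ^ k" by simp
  qed simp
  moreover have "- x / 2 + y / 2 \<le> - \<alpha> / 8 + \<alpha>\<^sup>2 * k"
    if "\<alpha> / 2 * (1 / 2) \<le> x" "y \<le> 1 * (k * (2 * \<alpha>\<^sup>2))" for x y
    using that by (simp add: algebra_simps)
  ultimately show ?thesis
    unfolding eq k_def[symmetric] K_def[symmetric] by blast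
qed

text \<open>\<open>S v\<close> is the set of out-neighbours of \<open>v\<close>. Each edge gains
  \<open>\<alpha> / 8\<close> and loses \<open>\<alpha>\<^sup>2\<close> per common out-neighbour. By
  \<open>common_nbrs_le\<close> the average loss is at most \<open>2 * h * \<alpha>\<^sup>2\<close>,
  which \<open>32 * h * \<alpha> \<le> 1\<close> makes at most half of the gain.\<close>

lemma surplus_ge_sparse:
  fixes \<alpha> :: real
  assumes G: "simple_graph G"
    and sparse: "\<And>x A. A \<subseteq> nbhd G x \<Longrightarrow> card {e\<in>edges G. e \<subseteq> A} \<le> h * card A"
    and S: "\<And>v. S v \<subseteq> nbhd G v" "\<And>v. card (S v) \<le> D"
    and orient: "\<And>u v. {u, v} \<in> edges G \<Longrightarrow> (u \<in> S v) \<noteq> (v \<in> S u)"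
    and \<alpha>: "0 < \<alpha>" "\<alpha>\<^sup>2 * (2 * real D) \<le> 1" "32 * real h * \<alpha> \<le> 1"
  shows "surplus G \<ge> card (edges G) * \<alpha> / 32"
proof -
  let ?V = "vertices G"
  define a where "a v i = (if i = v then pi / 4 else if i \<in> S v then - \<alpha> else 0)" for v i
  define f where "f T v = sin (\<Sum>i\<in>?V. if i \<in> T then a v i else - a v i)" for T v
  have fin: "finite ?V" using G by (simp add: simple_graph_def)
  have SV: "S v \<subseteq> ?V" for v using S(1) nbhd_subset[OF G] by blast
  have correlation: "(\<Sum>T\<in>Pow ?V. f T u * f T v) / card (Pow ?V) \<le> - \<alpha> / 8 + \<alpha>\<^sup>2 * card (S u \<inter> S v)"
    if uv: "{u, v} \<in> edges G" "u \<in> S v" for u v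
  proof -
    have "u \<in> ?V" "v \<in> ?V" "u \<noteq> v" using G uv(1) by (auto simp: simple_graph_def)
    moreover have "v \<notin> S u" using orient uv by blast
    moreover have "u \<notin> S u" "v \<notin> S v" using S(1) nbhd_irrefl[OF G] by blast+
    ultimately show ?thesis
      unfolding f_def sum_Pow_sin_sin[OF fin] a_def
      by (intro sin_correlation_le[where D = D]) (use fin SV uv(2) S(2) \<alpha> in auto)
  qed
  have edge: "(\<Sum>T\<in>Pow ?V. \<Prod>w\<in>e. f T w) / card (Pow ?V) \<le> - \<alpha> / 8 + \<alpha>\<^sup>2 * card (\<Inter>(S ` e))"
    if e: "e \<in> edges G" for e
  proof -
    obtain u v where uv: "e = {u, v}" "u \<noteq> v" using simple_edge[OF G e] by blast
    consider "u \<in> S v" | "v \<in> S u" using orient e uv(1) by blast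
    then show ?thesis
    proof cases
      case 1
      then show ?thesis using correlation[of u v] e uv by simp
    next
      case 2
      then show ?thesis using correlation[of v u] e uv by (simp add: insert_commute mult.commute Int_commute)
    qed
  qed
  have "(\<Sum>e\<in>edges G. (\<Sum>T\<in>Pow ?V. \<Prod>w\<in>e. f T w) / card (Pow ?V))
      \<le> (\<Sum>e\<in>edges G. - \<alpha> / 8 + \<alpha>\<^sup>2 * card (\<Inter>(S ` e)))"
    by (intro sum_mono edge)
  also have "\<dots> = - \<alpha> / 8 * card (edges G) + \<alpha>\<^sup>2 * real (\<Sum>e\<in>edges G. card (\<Inter>(S ` e)))"
    by (simp add: sum.distrib sum_distrib_left sum_negf sum_subtractf)
  also have "\<dots> \<le> - \<alpha> / 8 * card (edges G) + \<alpha>\<^sup>2 * real (2 * h * card (edges G))"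
    using common_nbrs_le[OF G sparse S(1)] by (intro add_left_mono mult_left_mono of_nat_mono) auto
  also have "\<dots> = - \<alpha> / 8 * card (edges G) + (32 * real h * \<alpha>) * (\<alpha> / 16 * card (edges G))"
    by (simp add: power2_eq_square)
  also have "\<dots> \<le> - \<alpha> / 8 * card (edges G) + 1 * (\<alpha> / 16 * card (edges G))"
    using \<alpha> by (intro add_left_mono mult_right_mono) auto
  finally have "(\<Sum>e\<in>edges G. (\<Sum>T\<in>Pow ?V. \<Prod>w\<in>e. f T w) / card (Pow ?V)) \<le> - \<alpha> / 16 * card (edges G)"
    by simp
  moreover have "surplus G \<ge> - (\<Sum>e\<in>edges G. (\<Sum>T\<in>Pow ?V. \<Prod>w\<in>e. f T w) / card (Pow ?V)) / 2"
    using fin by (intro surplus_ge_average[OF G]) (auto simp: f_def)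
  ultimately show ?thesis by (simp add: algebra_simps)
qed

section \<open>Random lists and the dense case\<close>

text \<open>A mean value estimate: the derivative of the \<open>n\<close>-th power is at most
  \<open>n\<close> on the unit interval.\<close>

lemma power_diff_le_mult:
  fixes x y :: real
  assumes "0 \<le> y" "y \<le> x" "x \<le> 1"
  shows "x ^ n - y ^ n \<le> n * (x - y)"
proof (induction n)
  case (Suc n)
  have "x ^ Suc n - y ^ Suc n = x * (x ^ n - y ^ n) + (x - y) * y ^ n"
    by (simp add: algebra_simps)
  also have "\<dots> \<le> 1 * (x ^ n - y ^ n) + (x - y) * 1"
    using assms by (intro add_mono mult_right_mono mult_left_mono) (auto intro: power_mono power_le_one)
  finally show ?case using Suc by (simp add: algebra_simps)
qed simp

text \<open>The matching lower estimate, with the derivative at the smaller point. The truncated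
  \<open>n - 1\<close> is harmless at 0, where the factor \<open>n\<close> vanishes.\<close>

lemma power_diff_ge_mult:
  fixes x y :: real
  assumes "0 \<le> y" "y \<le> x"
  shows "n * (x - y) * y ^ (n - 1) \<le> x ^ n - y ^ n"
proof (induction n)
  case (Suc n)
  have "real (Suc n) * (x - y) * y ^ (Suc n - 1) = y * (n * (x - y) * y ^ (n - 1)) + (x - y) * y ^ n"
    by (cases n) (simp_all add: algebra_simps)
  also have "\<dots> \<le> y * (x ^ n - y ^ n) + (x - y) * x ^ n"
    using assms Suc by (intro add_mono mult_left_mono power_mono) auto
  also have "\<dots> = x ^ Suc n - y ^ Suc n"
    by (simp add: algebra_simps)
  finally show ?case .
qed simp

lemma card_lists_avoiding:
  assumes "finite V" "A \<subseteq> V"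
  shows "card {xs \<in> {xs. set xs \<subseteq> V \<and> length xs = r}. set xs \<inter> A = {}} = (card V - card A) ^ r"
proof -
  have "{xs \<in> {xs. set xs \<subseteq> V \<and> length xs = r}. set xs \<inter> A = {}} =
      {xs. set xs \<subseteq> V - A \<and> length xs = r}"
    by auto
  then show ?thesis
    using assms by (simp add: card_lists_length_eq card_Diff_subset finite_subset)
qed

text \<open>\<open>q\<close> is the probability that a uniformly random list of length \<open>r\<close> avoids \<open>P\<close> (or \<open>Q\<close>), so the
  left-hand side is the covariance of two avoidance events.\<close>

lemma avoidance_correlation_le:
  fixes V :: "'v set"
  assumes V: "finite V" "P \<subseteq> V" "Q \<subseteq> V" and s: "card P = s" "card Q = s" "s \<ge> 1" "4 * s \<le> card V"
  defines "r \<equiv> card V div (4 * s)"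
  defines "q \<equiv> (1 - real s / card V) ^ r"
  defines "\<Omega> \<equiv> {xs. set xs \<subseteq> V \<and> length xs = r}"
  defines "f \<equiv> \<lambda>A xs. (if set xs \<inter> A = {} then 1 else 0) - q"
  shows "(\<Sum>xs\<in>\<Omega>. f P xs * f Q xs) / card \<Omega> \<le> card (P \<inter> Q) / (4 * s) - s / (16 * card V)"
proof -
  define N where "N = real (card V)"
  define k where "k = card (P \<inter> Q)"
  define I where "I A xs = (if set xs \<inter> A = {} then 1 else 0 :: real)" for A :: "'v set" and xs
  have fin: "finite \<Omega>" "finite P" "finite Q"
    unfolding \<Omega>_def using V finite_lists_length_eq[of V] by (auto intro: finite_subset)
  have N: "N \<ge> 4 * real s" "real s \<ge> 1" "N > 0" using s by (auto simp: N_def)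
  have k: "k \<le> s" unfolding k_def using card_mono[of P "P \<inter> Q"] fin s by auto
  have card_\<Omega>: "real (card \<Omega>) = N ^ r"
    using V(1) by (simp add: \<Omega>_def card_lists_length_eq N_def)
  have sum_I: "(\<Sum>xs\<in>\<Omega>. I A xs) = (N - card A) ^ r" if "A \<subseteq> V" for A
  proof -
    have "(\<Sum>xs\<in>\<Omega>. I A xs) = card {xs\<in>\<Omega>. set xs \<inter> A = {}}"
      using fin by (simp add: I_def sum.If_cases Int_def)
    also have "\<dots> = real ((card V - card A) ^ r)"
      unfolding \<Omega>_def card_lists_avoiding[OF V(1) that] ..
    finally show ?thesis using V(1) that by (simp add: N_def of_nat_diff card_mono)
  qed
  have cardU: "real (card (P \<union> Q)) = 2 * real s - k"
    using card_Un_Int[OF fin(2,3)] s by (simp add: k_def)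
  have q: "(N - s) ^ r = q * N ^ r"
    unfolding q_def N_def[symmetric] using N by (simp add: power_mult_distrib[symmetric] field_simps)
  \<comment> \<open>Avoiding both sets means avoiding their union; the remaining terms come from
    centring.\<close>
  have "(\<Sum>xs\<in>\<Omega>. f P xs * f Q xs) = (\<Sum>xs\<in>\<Omega>. I (P \<union> Q) xs - q * I P xs - q * I Q xs + q\<^sup>2)"
    unfolding f_def I_def
    by (intro sum.cong) (auto simp: power2_eq_square algebra_simps Int_Un_distrib)
  also have "\<dots> = (N - (2 * real s - k)) ^ r - q * (N - s) ^ r - q * (N - s) ^ r + N ^ r * q\<^sup>2"
    using V s cardU by (simp add: sum.distrib sum_subtractf sum_I card_\<Omega> flip: sum_distrib_left)
  also have "\<dots> = (N - (2 * real s - k)) ^ r - N ^ r * q\<^sup>2"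
    unfolding q by (simp add: power2_eq_square)
  finally have "(\<Sum>xs\<in>\<Omega>. f P xs * f Q xs) / card \<Omega> = ((N - (2 * real s - k)) / N) ^ r - q\<^sup>2"
    using N by (simp add: card_\<Omega> power_divide field_simps)
  also have "(N - (2 * real s - k)) / N = 1 - 2 * (s / N) + k / N"
    using N by (simp add: field_simps)
  also have "q\<^sup>2 = (1 - 2 * (s / N) + (s / N)\<^sup>2) ^ r"
    unfolding q_def N_def[symmetric] power_mult[symmetric] mult.commute[of r 2]
    unfolding power_mult by (simp add: power2_eq_square algebra_simps)
  finally have eq: "(\<Sum>xs\<in>\<Omega>. f P xs * f Q xs) / card \<Omega> =
      (1 - 2 * (s / N) + k / N) ^ r - (1 - 2 * (s / N) + (s / N)\<^sup>2) ^ r" .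
  \<comment> \<open>Both powers are compared with \<open>(1 - 2 * t) ^ r\<close>. The first exceeds
    it by at most \<open>r * (k / N)\<close>, the cost of the overlap; the second exceeds it by
    order \<open>r * t\<^sup>2\<close>, the source of the negative correlation.\<close>
  define t where "t = s / N"
  have t: "0 < t" "t \<le> 1 / 4" using N by (auto simp: t_def field_simps)
  \<comment> \<open>The length \<open>r\<close> lies between \<open>1 / (8 * t)\<close> and
    \<open>1 / (4 * t)\<close>: short enough to keep \<open>(1 - 2 * t) ^ r\<close> above 1/2, long
    enough to make \<open>r * t\<^sup>2\<close> of order \<open>t\<close>.\<close>
  have r: "real r * (4 * t) \<le> 1"
  proof -
    have "real (r * (4 * s)) \<le> N" unfolding r_def N_def by (intro of_nat_mono) simp
    then show ?thesis using N by (simp add: t_def field_simps)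
  qed
  have r': "real r * (8 * t) \<ge> 1"
  proof -
    have "r \<ge> 1" using s by (simp add: r_def div_greater_zero_iff Suc_leI)
    moreover have "card V < (r + 1) * (4 * s)"
      unfolding r_def using s(3) by (simp add: dividend_less_div_times add.commute)
    ultimately have "card V \<le> (r + r) * (4 * s)"
      by (meson add_left_mono less_imp_le_nat le_trans mult_le_mono1)
    then have "N \<le> real ((r + r) * (4 * s))" unfolding N_def by (intro of_nat_mono)
    then show ?thesis using N by (simp add: t_def field_simps)
  qed
  have "(1 - 2 * t + k / N) ^ r - (1 - 2 * t) ^ r \<le> r * (k / N)"
    using power_diff_le_mult[of "1 - 2 * t" "1 - 2 * t + k / N" r] t k N
    by (simp add: t_def field_simps)
  also have "r * (k / N) = (real r * (4 * t)) * (k / (4 * s))"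
    using N by (simp add: t_def field_simps)
  also have "\<dots> \<le> 1 * (k / (4 * s))"
    using r by (intro mult_right_mono) auto
  finally have upper: "(1 - 2 * t + k / N) ^ r - (1 - 2 * t) ^ r \<le> k / (4 * s)" by simp
  have "1 / 2 \<le> 1 - real r * (2 * t)" using r by simp
  also have "\<dots> \<le> (1 - 2 * t) ^ r"
    using Bernoulli_inequality[of "- (2 * t)" r] t by simp
  also have "\<dots> \<le> (1 - 2 * t) ^ (r - 1)"
    using t by (intro power_decreasing) auto
  finally have half: "1 / 2 \<le> (1 - 2 * t) ^ (r - 1)" .
  have "t / 16 = (1 / 8 * t) * (1 / 2)" by simp
  also have "\<dots> \<le> (real r * t * t) * (1 - 2 * t) ^ (r - 1)"
    using half r' t by (intro mult_mono) auto
  also have "\<dots> \<le> (1 - 2 * t + t\<^sup>2) ^ r - (1 - 2 * t) ^ r"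
    using power_diff_ge_mult[of "1 - 2 * t" "1 - 2 * t + t\<^sup>2" r] t
    by (simp add: power2_eq_square mult.assoc)
  finally have "t / 16 \<le> (1 - 2 * t + t\<^sup>2) ^ r - (1 - 2 * t) ^ r" .
  then show ?thesis
    unfolding eq using upper by (simp add: t_def N_def k_def)
qed

text \<open>Neighbourhoods are trimmed to a common size \<open>s\<close> so that all avoidance
  events have the same probability \<open>q\<close>. The overlaps cost \<open>h / (2 * s)\<close>
  per edge on average, at most half of the gain \<open>s / (16 * N)\<close> because
  \<open>16 * h * N \<le> s\<^sup>2\<close>.\<close>

lemma surplus_ge_dense:
  assumes G: "simple_graph G"
    and sparse: "\<And>x A. A \<subseteq> nbhd G x \<Longrightarrow> card {e\<in>edges G. e \<subseteq> A} \<le> h * card A"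
    and deg: "\<And>v. v \<in> vertices G \<Longrightarrow> card (nbhd G v) \<ge> s"
    and s: "s \<ge> 1" "4 * s \<le> card (vertices G)" "16 * h * card (vertices G) \<le> s\<^sup>2"
  shows "surplus G \<ge> card (edges G) * (s / (64 * card (vertices G)))"
proof -
  let ?V = "vertices G"
  define N where "N = real (card ?V)"
  define r where "r = card ?V div (4 * s)"
  define q where "q = (1 - real s / card ?V) ^ r"
  define \<Omega> where "\<Omega> = {xs. set xs \<subseteq> ?V \<and> length xs = r}"
  have "\<exists>A \<subseteq> nbhd G v. v \<in> ?V \<longrightarrow> card A = s" for v
    using deg[of v] obtain_subset_with_card_n[of s "nbhd G v"] by (metis subset_refl)
  then obtain S where S: "\<And>v. S v \<subseteq> nbhd G v" "\<And>v. v \<in> ?V \<Longrightarrow> card (S v) = s"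
    by metis
  define f where "f xs v = (if set xs \<inter> S v = {} then 1 else 0) - q" for xs v
  have fin: "finite ?V" using G by (simp add: simple_graph_def)
  have SV: "S v \<subseteq> ?V" for v using S(1) nbhd_subset[OF G] by blast
  have N: "N > 0" using s by (simp add: N_def)
  have "real s \<le> N" using s by (simp add: N_def)
  then have q: "0 \<le> q" "q \<le> 1"
    unfolding q_def N_def[symmetric] using N by (auto intro!: power_le_one)
  have edge: "(\<Sum>xs\<in>\<Omega>. \<Prod>w\<in>e. f xs w) / card \<Omega> \<le> card (\<Inter>(S ` e)) / (4 * s) - s / (16 * N)"
    if e: "e \<in> edges G" for e
  proof -
    obtain u v where uv: "e = {u, v}" "u \<noteq> v" "u \<in> ?V" "v \<in> ?V" using simple_edge[OF G e] .
    then show ?thesis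
      using avoidance_correlation_le[OF fin SV[of u] SV[of v] S(2)[OF uv(3)] S(2)[OF uv(4)] s(1,2)]
      unfolding f_def \<Omega>_def q_def r_def N_def by simp
  qed
  have "(\<Sum>e\<in>edges G. (\<Sum>xs\<in>\<Omega>. \<Prod>w\<in>e. f xs w) / card \<Omega>)
      \<le> (\<Sum>e\<in>edges G. card (\<Inter>(S ` e)) / (4 * s) - s / (16 * N))"
    by (intro sum_mono edge)
  also have "\<dots> = real (\<Sum>e\<in>edges G. card (\<Inter>(S ` e))) / (4 * s) - card (edges G) * (s / (16 * N))"
    by (simp add: sum_subtractf sum_divide_distrib)
  also have "\<dots> \<le> real (2 * h * card (edges G)) / (4 * s) - card (edges G) * (s / (16 * N))"
    using common_nbrs_le[OF G sparse S(1)] by (intro diff_right_mono divide_right_mono of_nat_mono) auto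
  also have "\<dots> = card (edges G) * (h / (2 * s) - s / (16 * N))"
    by (simp add: field_simps)
  also have "\<dots> \<le> card (edges G) * (- (s / (32 * N)))"
  proof (intro mult_left_mono)
    have "real (16 * h * card ?V) \<le> real (s\<^sup>2)" using s(3) by (rule of_nat_mono)
    then have "16 * h * N \<le> real s * s" by (simp add: N_def power2_eq_square)
    then have "h / (2 * s) \<le> s / (32 * N)" using N s(1) by (simp add: field_simps)
    then show "h / (2 * s) - s / (16 * N) \<le> - (s / (32 * N))" by simp
  qed simp
  finally have "(\<Sum>e\<in>edges G. (\<Sum>xs\<in>\<Omega>. \<Prod>w\<in>e. f xs w) / card \<Omega>) \<le> - (card (edges G) * (s / (32 * N)))"
    by simp
  moreover have "surplus G \<ge> - (\<Sum>e\<in>edges G. (\<Sum>xs\<in>\<Omega>. \<Prod>w\<in>e. f xs w) / card \<Omega>) / 2"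
  proof (rule surplus_ge_average[OF G])
    show "finite \<Omega>" using fin finite_lists_length_eq[of ?V r] by (simp add: \<Omega>_def)
    obtain x where "x \<in> ?V" using N by (fastforce simp: N_def)
    then have "replicate r x \<in> \<Omega>" by (auto simp: \<Omega>_def)
    then show "\<Omega> \<noteq> {}" by blast
    show "\<bar>f xs v\<bar> \<le> 1" for xs v using q by (auto simp: f_def)
  qed
  ultimately show ?thesis by (simp add: N_def)
qed

section \<open>Balancing the two cases\<close>

text \<open>\<open>u \<in> S v\<close> means that the edge is directed from \<open>v\<close> to
  \<open>u\<close>. A vertex of degree at most \<open>D\<close> in the current set is peeled off and
  sends out all its remaining edges.\<close>

lemma degenerate_orientation:
  assumes G: "simple_graph G"
    and D: "\<And>U. U \<subseteq> vertices G \<Longrightarrow> U \<noteq> {} \<Longrightarrow> \<exists>v\<in>U. card (nbhd G v \<inter> U) \<le> D"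
  obtains S where "\<And>v. S v \<subseteq> nbhd G v" "\<And>v. card (S v) \<le> D"
    "\<And>u v. {u, v} \<in> edges G \<Longrightarrow> (u \<in> S v) \<noteq> (v \<in> S u)"
proof -
  have "\<exists>S. (\<forall>v. S v \<subseteq> nbhd G v \<inter> U \<and> card (S v) \<le> D) \<and>
      (\<forall>u\<in>U. \<forall>v\<in>U. {u, v} \<in> edges G \<longrightarrow> (u \<in> S v) \<noteq> (v \<in> S u))"
    if "finite U" "U \<subseteq> vertices G" for U
    using that
  proof (induction "card U" arbitrary: U)
    case 0
    then have "U = {}" by simp
    then show ?case by (intro exI[of _ "\<lambda>_. {}"]) simp
  next
    case (Suc n)
    then have "U \<noteq> {}" by auto
    then obtain v where v: "v \<in> U" "card (nbhd G v \<inter> U) \<le> D" using D Suc.prems(2) by blast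
    have "n = card (U - {v})" "finite (U - {v})" "U - {v} \<subseteq> vertices G"
      using Suc(2) v(1) Suc.prems by auto
    from Suc(1)[OF this] obtain S where
      S: "\<forall>w. S w \<subseteq> nbhd G w \<inter> (U - {v}) \<and> card (S w) \<le> D"
      "\<forall>u\<in>U - {v}. \<forall>w\<in>U - {v}. {u, w} \<in> edges G \<longrightarrow> (u \<in> S w) \<noteq> (w \<in> S u)"
      by (elim exE conjE)
    \<comment> \<open>The earlier sets lie in \<open>U - {v}\<close>, so no edge at \<open>v\<close>
      is directed twice.\<close>
    let ?S = "S(v := nbhd G v \<inter> U)"
    have "(u \<in> ?S w) \<noteq> (w \<in> ?S u)" if uw: "u \<in> U" "w \<in> U" "{u, w} \<in> edges G" for u w
    proof -
      have "u \<noteq> w" using uw(3) G by (auto simp: simple_graph_def)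
      have adj: "u \<in> nbhd G w" "w \<in> nbhd G u" using uw(3) by (simp_all add: nbhd_def insert_commute)
      have no_v: "v \<notin> S x" for x using S(1) by blast
      consider "u = v" | "w = v" | "u \<noteq> v" "w \<noteq> v" by auto
      then show ?thesis
        using S(2) uw adj no_v \<open>u \<noteq> w\<close> by cases auto
    qed
    moreover have "?S w \<subseteq> nbhd G w \<inter> U \<and> card (?S w) \<le> D" for w
      using S(1) v(2) by auto
    ultimately show ?case by blast
  qed
  moreover have "finite (vertices G)" using G by (simp add: simple_graph_def)
  ultimately have "\<exists>S. (\<forall>v. S v \<subseteq> nbhd G v \<inter> vertices G \<and> card (S v) \<le> D) \<and>
      (\<forall>u\<in>vertices G. \<forall>v\<in>vertices G. {u, v} \<in> edges G \<longrightarrow> (u \<in> S v) \<noteq> (v \<in> S u))"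
    by simp
  then obtain S where
    S: "\<forall>v. S v \<subseteq> nbhd G v \<inter> vertices G \<and> card (S v) \<le> D"
      "\<forall>u\<in>vertices G. \<forall>v\<in>vertices G. {u, v} \<in> edges G \<longrightarrow> (u \<in> S v) \<noteq> (v \<in> S u)"
    by (elim exE conjE)
  show thesis
  proof (rule that[of S])
    show "S v \<subseteq> nbhd G v" "card (S v) \<le> D" for v using S(1) by auto
    fix u v assume uv: "{u, v} \<in> edges G"
    then have "u \<in> vertices G" "v \<in> vertices G" using G by (auto simp: simple_graph_def)
    then show "(u \<in> S v) \<noteq> (v \<in> S u)" using S(2) uv by blast
  qed
qed

text \<open>Take \<open>s\<close> about \<open>D / 4\<close> in \<open>surplus_ge_dense\<close>.
  Counting degrees gives \<open>N * D \<le> 2 * card (edges G)\<close>, which turns the cubic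
  hypothesis into \<open>16 * h * N \<le> s\<^sup>2\<close> and the surplus bound into one of order
  \<open>D\<^sup>2\<close>.\<close>

lemma surplus_ge_min_degree:
  assumes G: "simple_graph G"
    and sparse: "\<And>x A. A \<subseteq> nbhd G x \<Longrightarrow> card {e\<in>edges G. e \<subseteq> A} \<le> h * card A"
    and ne: "vertices G \<noteq> {}"
    and deg: "\<And>v. v \<in> vertices G \<Longrightarrow> card (nbhd G v) > D"
    and D: "D \<ge> 4" "2048 * h * card (edges G) \<le> D ^ 3"
  shows "surplus G \<ge> (real D)\<^sup>2 / 1024"
proof -
  define N where "N = card (vertices G)"
  define s where "s = D div 4"
  have fin: "finite (vertices G)" using G by (simp add: simple_graph_def)
  have "N * D = (\<Sum>v\<in>vertices G. D)" by (simp add: N_def)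
  also have "\<dots> \<le> (\<Sum>v\<in>vertices G. card (nbhd G v))"
    using deg by (intro sum_mono) (simp add: less_imp_le)
  finally have ND: "N * D \<le> 2 * card (edges G)" by (simp add: sum_card_nbhd[OF G])
  obtain v where v: "v \<in> vertices G" using ne by auto
  have "card (nbhd G v) \<le> N" unfolding N_def using nbhd_subset[OF G] fin by (intro card_mono)
  then have "D < N" using deg[OF v] by simp
  \<comment> \<open>Rounding down loses at most a factor 2 since \<open>D \<ge> 4\<close>.\<close>
  have s: "D \<le> 8 * s" "4 * s \<le> D" "s \<ge> 1" using D(1) unfolding s_def by presburger+
  have "(16 * h * N) * (64 * D) = 1024 * h * (N * D)" by simp
  also have "\<dots> \<le> 1024 * h * (2 * card (edges G))" by (intro mult_left_mono ND) simp
  also have "\<dots> \<le> D ^ 3" using D(2) by simp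
  also have "\<dots> = D\<^sup>2 * D" by (simp add: power2_eq_square power3_eq_cube)
  also have "\<dots> \<le> (8 * s)\<^sup>2 * D" using s(1) by (intro mult_right_mono power_mono) auto
  also have "\<dots> = s\<^sup>2 * (64 * D)" by (simp add: power2_eq_square)
  finally have s2: "16 * h * N \<le> s\<^sup>2" using D(1) by (simp add: mult_ac)
  have "(real D)\<^sup>2 / 1024 = real D / 2 * (real D / 8) / 64" by (simp add: power2_eq_square)
  also have "\<dots> \<le> real D / 2 * s / 64" using s(1) by (intro divide_right_mono mult_left_mono) auto
  also have "\<dots> = real (N * D) / 2 * (s / (64 * N))" using \<open>D < N\<close> by simp
  also have "\<dots> \<le> card (edges G) * (s / (64 * N))"
    using of_nat_mono[OF ND, where 'a = real] by (intro mult_right_mono) auto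
  also have "\<dots> \<le> surplus G"
    unfolding N_def
  proof (rule surplus_ge_dense[OF G sparse])
    show "s \<le> card (nbhd G v)" if "v \<in> vertices G" for v using deg[OF that] s(2) by simp
    show "4 * s \<le> card (vertices G)" using \<open>D < N\<close> s(2) by (simp add: N_def)
  qed (use s(3) s2 in \<open>simp_all add: N_def\<close>)
  finally show ?thesis .
qed

lemma surplus_ge_powr:
  fixes H :: "'a ugraph" and G :: "'b ugraph"
  assumes H: "simple_graph H" "z \<in> vertices H" "acyclic_graph (delete_vertex H z)"
    and G: "simple_graph G" "graph_free H G" and m: "card (edges G) = m" "m > 0"
  shows "surplus G \<ge> 1 / (2048 * real (card (vertices H))) * m powr (4 / 5)"
proof -
  define h where "h = card (vertices H)"
  define x where "x = real m powr (2 / 5)"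
  \<comment> \<open>With \<open>D\<close> of order \<open>m powr (2 / 5)\<close>, both
    \<open>m / sqrt D\<close> and \<open>D\<^sup>2\<close> have order \<open>m powr (4 / 5)\<close>.
    The factor \<open>512 * h\<^sup>2\<close> gives \<open>32 * h \<le> sqrt (2 * D)\<close>, as the
    sparse case requires.\<close>
  define D where "D = nat \<lceil>512 * (real h)\<^sup>2 * x\<rceil>"
  have "finite (vertices H)" using H(1) by (simp add: simple_graph_def)
  then have h: "h \<ge> 1" using H(2) by (auto simp: h_def Suc_le_eq card_gt_0_iff)
  then have h2: "1 \<le> (real h)\<^sup>2" "real h \<le> (real h)\<^sup>2"
    by (simp_all add: power2_eq_square one_le_power[of "real h" 2, unfolded power2_eq_square])
  have x: "x \<ge> 1" unfolding x_def using m by (intro ge_one_powr_ge_zero) auto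
  have hx: "(real h)\<^sup>2 \<le> (real h)\<^sup>2 * x" using mult_left_mono[OF x, of "(real h)\<^sup>2"] by simp
  have D_ge: "512 * (real h)\<^sup>2 * x \<le> D" unfolding D_def by (rule real_nat_ceiling_ge)
  have "0 \<le> 512 * (real h)\<^sup>2 * x" using x by simp
  then have "real D \<le> 512 * (real h)\<^sup>2 * x + 1"
    unfolding D_def by linarith
  \<comment> \<open>Rounding up at most doubles the value, as
    \<open>h\<^sup>2 * x \<ge> 1\<close>.\<close>
  then have D_le: "real D \<le> 1024 * (real h)\<^sup>2 * x" using hx h2 by linarith
  have D_ge_h: "512 * (real h)\<^sup>2 \<le> D" using D_ge hx by linarith
  then have D4: "D \<ge> 4" using h2 by linarith
  have x2: "x\<^sup>2 = m powr (4 / 5)" using m by (simp add: x_def powr_power)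
  consider "\<And>U. U \<subseteq> vertices G \<Longrightarrow> U \<noteq> {} \<Longrightarrow> \<exists>v\<in>U. card (nbhd G v \<inter> U) \<le> D"
    | U where "U \<subseteq> vertices G" "U \<noteq> {}" "\<And>v. v \<in> U \<Longrightarrow> card (nbhd G v \<inter> U) > D"
    by (meson not_le)
  then show ?thesis
  proof cases
    case 1
    then obtain S where S: "\<And>v. S v \<subseteq> nbhd G v" "\<And>v. card (S v) \<le> D"
      "\<And>u v. {u, v} \<in> edges G \<Longrightarrow> (u \<in> S v) \<noteq> (v \<in> S u)"
      using degenerate_orientation[OF G(1)] by blast
    \<comment> \<open>The largest value allowed by
      \<open>\<alpha>\<^sup>2 * (2 * D) \<le> 1\<close>.\<close>
    define \<alpha> where "\<alpha> = 1 / sqrt (2 * real D)"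
    have \<alpha>: "0 < \<alpha>" "\<alpha>\<^sup>2 * (2 * real D) \<le> 1"
      using D4 by (simp_all add: \<alpha>_def power_divide)
    have "32 * real h \<le> sqrt (2 * real D)"
      using D_ge_h by (intro real_le_rsqrt) (simp add: power2_eq_square)
    then have \<alpha>h: "32 * real h * \<alpha> \<le> 1"
      using D4 by (simp add: \<alpha>_def)
    have "sqrt (2 * real D) \<le> 64 * real h * m powr (1 / 5)"
    proof (rule real_le_lsqrt)
      have "2 * real D \<le> (64 * real h)\<^sup>2 * x"
        using D_le hx h2 by (simp add: power_mult_distrib mult_ac)
      also have "x = (m powr (1 / 5))\<^sup>2" using m by (simp add: x_def powr_power)
      finally show "2 * real D \<le> (64 * real h * m powr (1 / 5))\<^sup>2" by (simp add: power_mult_distrib)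
    qed auto
    then have "1 / (64 * real h * m powr (1 / 5)) \<le> \<alpha>"
      unfolding \<alpha>_def using D4 h m by (intro divide_left_mono) auto
    then have "m * (1 / (64 * real h * m powr (1 / 5))) / 32 \<le> m * \<alpha> / 32"
      by (intro divide_right_mono mult_left_mono) auto
    also have "\<dots> \<le> surplus G"
      using surplus_ge_sparse[OF G(1) locally_sparse[OF H G, folded h_def] S \<alpha> \<alpha>h] m(1) by simp
    also have "m * (1 / (64 * real h * m powr (1 / 5))) / 32 =
        1 / (2048 * real h) * (m powr 1 / m powr (1 / 5))"
      using m by simp
    also have "m powr 1 / m powr (1 / 5) = m powr (4 / 5)"
      unfolding powr_diff[symmetric] by simp
    finally show ?thesis by (simp add: h_def)
  next
    case 2
    let ?G = "induced G U"
    have sub: "is_subgraph ?G G" using is_subgraph_induced[OF G(1) 2(1)] .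
    then have G': "simple_graph ?G" "graph_free H ?G"
      using graph_free_subgraph[OF G(2)] by (auto simp: is_subgraph_def)
    have VG': "vertices ?G = U" by (simp add: induced_def)
    have "edges ?G \<subseteq> edges G" by (auto simp: induced_def)
    then have "card (edges ?G) \<le> m"
      using card_mono[OF finite_edges[OF G(1)]] m(1) by blast
    moreover have "2048 * real h * real m \<le> real D ^ 3"
    proof -
      have "2048 * real h * real m \<le> 512 ^ 3 * ((real h)\<^sup>2 * 1) * m"
      proof (rule mult_right_mono)
        have "2048 * real h \<le> 512 ^ 3 * real h" by simp
        also have "\<dots> \<le> 512 ^ 3 * ((real h)\<^sup>2 * 1)"
          unfolding mult_1_right using h2(2) by (rule mult_left_mono) simp
        finally show "2048 * real h \<le> 512 ^ 3 * ((real h)\<^sup>2 * 1)" .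
      qed simp
      also have "\<dots> \<le> 512 ^ 3 * ((real h)\<^sup>2 * ((real h)\<^sup>2 * (real h)\<^sup>2)) * x ^ 3"
      proof (intro mult_mono)
        show "1 \<le> (real h)\<^sup>2 * (real h)\<^sup>2" using h2 mult_mono[of 1 "(real h)\<^sup>2" 1 "(real h)\<^sup>2"] by simp
        \<comment> \<open>The cube of \<open>x\<close> has exponent 6/5, so the cubic condition of
          the dense case holds with room to spare.\<close>
        have "real m powr 1 \<le> m powr (6 / 5)" using m by (intro powr_mono) auto
        also have "\<dots> = x ^ 3" using m by (simp add: x_def powr_power)
        finally show "real m \<le> x ^ 3" using m by simp
      qed auto
      also have "\<dots> = (512 * (real h)\<^sup>2 * x) ^ 3"
        by (simp add: power_mult_distrib power3_eq_cube)
      also have "\<dots> \<le> real D ^ 3"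
        using D_ge x by (intro power_mono) auto
      finally show ?thesis .
    qed
    then have "2048 * h * m \<le> D ^ 3"
      by (metis (mono_tags, lifting) of_nat_le_iff of_nat_mult of_nat_numeral of_nat_power)
    ultimately have "2048 * h * card (edges ?G) \<le> D ^ 3"
      by (meson le_trans mult_le_mono2)
    then have "(real D)\<^sup>2 / 1024 \<le> surplus ?G"
      using 2(2,3) D4
      by (intro surplus_ge_min_degree[OF G'(1) locally_sparse[OF H G', folded h_def]])
        (auto simp: VG' nbhd_induced)
    then have "(real D)\<^sup>2 / 1024 \<le> surplus G"
      using surplus_induced_le[OF G(1) 2(1)] by simp
    moreover have "x\<^sup>2 \<le> (real D)\<^sup>2 / 1024"
    proof -
      have "32 * x \<le> 512 * (real h)\<^sup>2 * x" using h2 x by (intro mult_right_mono) auto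
      then have "32 * x \<le> D" using D_ge by linarith
      then have "(32 * x)\<^sup>2 \<le> (real D)\<^sup>2" using x by (intro power_mono) auto
      then show ?thesis by (simp add: power_mult_distrib)
    qed
    moreover have "1 / (2048 * real h) * m powr (4 / 5) \<le> 1 * m powr (4 / 5)"
      using h by (intro mult_right_mono) auto
    ultimately show ?thesis unfolding x2 h_def by simp
  qed
qed

theorem theorem1p2:
  fixes H :: "'a ugraph"
  assumes "simple_graph H"
    and "\<exists>v \<in> vertices H. acyclic_graph (delete_vertex H v)"
  shows "\<exists>c :: real. c > 0 \<and>
           (\<forall>m :: nat. m > 0 \<longrightarrow> min_surplus m H \<ge> ereal (c * real m powr (4 / 5)))"
proof -
  obtain z where z: "z \<in> vertices H" "acyclic_graph (delete_vertex H z)"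
    using assms(2) by blast
  let ?c = "1 / (2048 * real (card (vertices H)))"
  have "?c > 0" using assms(1) z(1) by (auto simp: simple_graph_def card_gt_0_iff)
  \<comment> \<open>A bound for every member of the class bounds the infimum, and also covers an
    empty class, where the infimum is infinite.\<close>
  moreover have "min_surplus m H \<ge> ereal (?c * real m powr (4 / 5))" if "m > 0" for m
    unfolding min_surplus_def
  proof (rule INF_greatest)
    fix G assume "G \<in> free_graphs m H"
    then have "simple_graph G" "graph_free H G" "card (edges G) = m"
      by (simp_all add: free_graphs_def)
    from surplus_ge_powr[OF assms(1) z this that]
    show "ereal (?c * real m powr (4 / 5)) \<le> ereal (surplus G)"
      unfolding ereal_less_eq .
  qed
  ultimately show ?thesis by blast
qed

end
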